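(* Let $f^0(x,y)$ be a curvature surface defined on $D=\{(x,y)\in\mathbb{R}^2:x>0\}$ and $F^0=[\phi,X^0_\alpha,X^0_\beta,\xi]$ the orthonormal frame field determining $f^0$; let $\tilde{\boldsymbol{u}}(x),\tilde A(x),B_2,C_2,T(x),\tilde w(x)$ and the orthonormal frame $[\boldsymbol{b}^\infty,\boldsymbol{c}^\infty,\tilde{\boldsymbol{b}}^\infty,\tilde{\boldsymbol{c}}^\infty]$ be as in the context. Then: (1) There is a unit vector $\tilde{\boldsymbol{v}}_1(x)$ such that $\frac{d\tilde{\boldsymbol{u}}}{dx}(x)=T(x)\tilde{\boldsymbol{v}}_1(x)$ and $\frac{d\tilde{\boldsymbol{v}}_1}{dx}(x)=-T(x)\tilde{\boldsymbol{u}}(x)$ hold. Furthermore, $\tilde{\boldsymbol{u}}(x)$ and $\tilde{\boldsymbol{v}}_1(x)$, respectively, are expressed as $$\tilde{\boldsymbol{u}}(x)=\cos\tilde w(x)\,\boldsymbol{b}^\infty+\sin\tilde w(x)\,\boldsymbol{c}^\infty,\qquad \tilde{\boldsymbol{v}}_1(x)=-\sin\tilde w(x)\,\boldsymbol{b}^\infty+\cos\tilde w(x)\,\boldsymbol{c}^\infty.$$ (2) As $y$ tends to $\infty$, each $y$-curve $f^0(x,y)$ with fixed $x$ converges uniformly to the point $(B_2^2+C_2^2)^{-1/2}(x)\,\tilde{\boldsymbol{v}}_1(x)+\tilde A(x)$. (3) As $y$ tends to $\infty$, every $y$-curve $X^0_\beta(x,y)$ (resp. every $y$-curve $\phi(x,y)$)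 with $x$ fixed uniformly converges to the circle $\tilde{\boldsymbol{b}}(y)=\cos y\,\tilde{\boldsymbol{b}}^\infty+\sin y\,\tilde{\boldsymbol{c}}^\infty$ (resp. $-\tilde{\boldsymbol{c}}(y)=\sin y\,\tilde{\boldsymbol{b}}^\infty-\cos y\,\tilde{\boldsymbol{c}}^\infty$). Furthermore, the convergences for these $y$-curves in (2) and (3) are uniform in the wider sense with respect to $x\in(0,\infty)$.
   Context: $X_0(x)=\frac52+\sum_{k\ge1}a_kx^{2k}$ (analytic on $\mathbb{R}$), where the coefficients are given by $a_1=1$, $2(k+1)(4k^2+\frac54)a_{k+1}+(2k-1)a_k=0$ $(k\ge1)$. $h(x,y)=2X_0-xX_0'+y^2\frac{X_0'}{x}+\sqrt5$ (positive). $B_2(x)=-\frac12\frac{X_0'}{x}-\sqrt5$, $C_2(x)=X_0''-\frac{X_0'}{x}$. On $D$ define the functions (not to be confused with the coefficients above) $a_1=\frac{2y}{xh}(X_0+\frac{\sqrt5}{2})$, $b_1=-\frac{1}{xh}(X_0+\frac{\sqrt5}{2}+\sqrt5(x^2-y^2))$, $c_1=-\frac{2}{xh}(X_0+\frac{\sqrt5}{2})$, $a_2=-\frac1h(2X_0+\sqrt5-(x^2+y^2)\frac{X_0'}{x})$, $b_2=-\frac{2y}{h}(\frac{X_0'}{2x}+\sqrt5)$, $c_2=\frac{2y}{h}(X_0''-\frac{X_0'}{x})$. The frame field is an analytic orthonormal frame field $F^0=[\phi,X^0_\alpha,X^0_\beta,\xi]$ of $\mathbb{R}^4$ on $D$ satisfying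 $\phi_x=-a_1X^0_\alpha$, $\xi_x=b_1X^0_\alpha$, $(X^0_\beta)_x=c_1X^0_\alpha$, $(X^0_\alpha)_x=a_1\phi-b_1\xi-c_1X^0_\beta$, $\phi_y=-a_2X^0_\beta$, $\xi_y=b_2X^0_\beta$, $(X^0_\alpha)_y=c_2X^0_\beta$, $(X^0_\beta)_y=a_2\phi-b_2\xi-c_2X^0_\alpha$ (it exists and is unique up to left multiplication by a constant orthogonal matrix). The curvature surface $f^0:D\to\mathbb{R}^4$ determined by $F^0$ is the analytic map, unique up to translation, with $df^0=\frac{x^2-y^2}{xh}X^0_\alpha dx+\frac{2y}{h}X^0_\beta dy$. $\tilde{\boldsymbol{u}}(x)=(B_2^2+C_2^2)^{-1/2}(x)(-B_2X^0_\alpha+C_2\xi)(x,y)$ and $\tilde A(x)=f^0(x,y)-(B_2^2+C_2^2)^{-1}(x)(B_2\xi+C_2X^0_\alpha)(x,y)$ are independent of $y$. $T(x)=\frac{(X_0'+2\sqrt5x)(2X_0+\sqrt5)}{4xX_0'(2X_0-xX_0'-X_0'/x+\sqrt5)}$ for $x>0$; one has $T(x)=\frac{\sqrt5}{2x}+O(x)$ as $x\to0$, and $\tilde w(x):=\frac{\sqrt5}{2}\log x+\int_0^x\big[T(s)-\frac{\sqrt5}{2s}\big]ds$. $(\boldsymbol{b}^\infty,\boldsymbol{c}^\infty)$ is the orthonormal pair of constant vectors such that $X^0_\alpha(e^{-u},y)-(\cos\frac{\sqrt5u}{2}\boldsymbol{b}^\infty-\sin\frac{\sqrt5u}{2}\boldsymbol{c}^\infty)\to0$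 as $u\to\infty$ for every $y$. $(\tilde{\boldsymbol{b}}^\infty,\tilde{\boldsymbol{c}}^\infty)$ is the orthonormal pair of constant vectors such that $\boldsymbol{u}(y):=(1+y^2)^{-1/2}(yX^0_\beta-\phi)(x,y)$ (independent of $x$) equals $-\sin(y-\arctan y)\,\tilde{\boldsymbol{b}}^\infty+\cos(y-\arctan y)\,\tilde{\boldsymbol{c}}^\infty$, with $\frac{d\boldsymbol{u}}{dy}=\frac{y^2}{1+y^2}\boldsymbol{v}_1(y)$, $\boldsymbol{v}_1(y)=-\cos(y-\arctan y)\,\tilde{\boldsymbol{b}}^\infty-\sin(y-\arctan y)\,\tilde{\boldsymbol{c}}^\infty$; $[\boldsymbol{b}^\infty,\boldsymbol{c}^\infty,\tilde{\boldsymbol{b}}^\infty,\tilde{\boldsymbol{c}}^\infty]$ is an orthonormal base of $\mathbb{R}^4$. Here $\tilde{\boldsymbol{c}}(y):=-\sin y\,\tilde{\boldsymbol{b}}^\infty+\cos y\,\tilde{\boldsymbol{c}}^\infty$. A $y$-curve is the curve obtained by fixing $x$. "$M(y)$ converges uniformly to $N(y)$ as $y\to\infty$" means that for any $\varepsilon>0$ there is a number $R$ with $\|M(y)-N(y)\|<\varepsilon$ for $y>R$; "uniform in the wider sense with respect to $x$" means that $R$ can be chosen independently of $x$ in each compact subset of $(0,\infty)$.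
   Formalization: In (3) the printed limit of φ(x,y), −c̃(y) = sin y b̃^∞ − cos y c̃^∞, has the wrong sign under the stated conventions (a_2 → 1 gives φ − v_1 → 0 and v_1 → c̃); the formal statement proves convergence of φ to +c̃(y) = −sin y b̃^∞ + cos y c̃^∞ instead. *)

theory Defs
  imports "HOL-Analysis.Analysis"
begin

fun X0_coeff :: "nat \<Rightarrow> real" where
  "X0_coeff 0 = 5 / 2"
| "X0_coeff (Suc 0) = 1"
| "X0_coeff (Suc (Suc k)) =
     (let n = real (Suc k)
      in - ((2 * n - 1) * X0_coeff (Suc k)) / (2 * (n + 1) * (4 * n\<^sup>2 + 5 / 4)))"

definition X0 :: "real \<Rightarrow> real" where
  "X0 x = (\<Sum>k. X0_coeff k * x ^ (2 * k))"

abbreviation X0' :: "real \<Rightarrow> real" where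
  "X0' \<equiv> deriv X0"

abbreviation X0'' :: "real \<Rightarrow> real" where
  "X0'' \<equiv> deriv (deriv X0)"

definition h :: "real \<Rightarrow> real \<Rightarrow> real" where
  "h x y = 2 * X0 x - x * X0' x + y\<^sup>2 * (X0' x / x) + sqrt 5"

definition a\<^sub>1 :: "real \<Rightarrow> real \<Rightarrow> real" where
  "a\<^sub>1 x y = 2 * y / (x * h x y) * (X0 x + sqrt 5 / 2)"

definition b\<^sub>1 :: "real \<Rightarrow> real \<Rightarrow> real" where
  "b\<^sub>1 x y = - (1 / (x * h x y)) * (X0 x + sqrt 5 / 2 + sqrt 5 * (x\<^sup>2 - y\<^sup>2))"

definition c\<^sub>1 :: "real \<Rightarrow> real \<Rightarrow> real" where
  "c\<^sub>1 x y = - (2 / (x * h x y)) * (X0 x + sqrt 5 / 2)"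

definition a\<^sub>2 :: "real \<Rightarrow> real \<Rightarrow> real" where
  "a\<^sub>2 x y = - (1 / h x y) * (2 * X0 x + sqrt 5 - (x\<^sup>2 + y\<^sup>2) * (X0' x / x))"

definition b\<^sub>2 :: "real \<Rightarrow> real \<Rightarrow> real" where
  "b\<^sub>2 x y = - (2 * y / h x y) * (X0' x / (2 * x) + sqrt 5)"

definition c\<^sub>2 :: "real \<Rightarrow> real \<Rightarrow> real" where
  "c\<^sub>2 x y = 2 * y / h x y * (X0'' x - X0' x / x)"

definition B\<^sub>2 :: "real \<Rightarrow> real" where
  "B\<^sub>2 x = - (1 / 2) * (X0' x / x) - sqrt 5"

definition C\<^sub>2 :: "real \<Rightarrow> real" where
  "C\<^sub>2 x = X0'' x - X0' x / x"

definition T :: "real \<Rightarrow> real" where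
  "T x = ((X0' x + 2 * sqrt 5 * x) * (2 * X0 x + sqrt 5))
       / (4 * x * X0' x * (2 * X0 x - x * X0' x - X0' x / x + sqrt 5))"

definition w_tilde :: "real \<Rightarrow> real" where
  "w_tilde x = sqrt 5 / 2 * ln x + integral {0..x} (\<lambda>s. T s - sqrt 5 / (2 * s))"

definition D :: "(real \<times> real) set" where
  "D = {(x, y). x > 0}"

definition real_analytic_on :: "(real \<times> real \<Rightarrow> real ^ 4) \<Rightarrow> (real \<times> real) set \<Rightarrow> bool" where
  "real_analytic_on F S \<longleftrightarrow>
     (\<forall>(x0, y0) \<in> S. \<exists>r > 0. \<exists>c :: nat \<Rightarrow> nat \<Rightarrow> real ^ 4. \<forall>x y.
        \<bar>x - x0\<bar> < r \<and> \<bar>y - y0\<bar> < r \<longrightarrow>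
        ((\<lambda>(i, j). ((x - x0) ^ i * (y - y0) ^ j) *\<^sub>R c i j) has_sum F (x, y)) UNIV)"

definition orthonormal :: "(real ^ 4) list \<Rightarrow> bool" where
  "orthonormal vs \<longleftrightarrow>
     (\<forall>i < length vs. \<forall>j < length vs. vs ! i \<bullet> vs ! j = (if i = j then 1 else 0))"

definition frame_field ::
  "(real \<times> real \<Rightarrow> real ^ 4) \<Rightarrow> (real \<times> real \<Rightarrow> real ^ 4) \<Rightarrow>
   (real \<times> real \<Rightarrow> real ^ 4) \<Rightarrow> (real \<times> real \<Rightarrow> real ^ 4) \<Rightarrow> bool" where
  "frame_field \<phi> X\<^sub>\<alpha> X\<^sub>\<beta> \<xi> \<longleftrightarrow>
     real_analytic_on \<phi> D \<and> real_analytic_on X\<^sub>\<alpha> D \<and>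
     real_analytic_on X\<^sub>\<beta> D \<and> real_analytic_on \<xi> D \<and>
     (\<forall>p \<in> D. orthonormal [\<phi> p, X\<^sub>\<alpha> p, X\<^sub>\<beta> p, \<xi> p]) \<and>
     (\<forall>(x, y) \<in> D.
       ((\<lambda>s. \<phi> (s, y)) has_vector_derivative - a\<^sub>1 x y *\<^sub>R X\<^sub>\<alpha> (x, y)) (at x) \<and>
       ((\<lambda>s. \<xi> (s, y)) has_vector_derivative b\<^sub>1 x y *\<^sub>R X\<^sub>\<alpha> (x, y)) (at x) \<and>
       ((\<lambda>s. X\<^sub>\<beta> (s, y)) has_vector_derivative c\<^sub>1 x y *\<^sub>R X\<^sub>\<alpha> (x, y)) (at x) \<and>
       ((\<lambda>s. X\<^sub>\<alpha> (s, y)) has_vector_derivative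
          a\<^sub>1 x y *\<^sub>R \<phi> (x, y) - b\<^sub>1 x y *\<^sub>R \<xi> (x, y) - c\<^sub>1 x y *\<^sub>R X\<^sub>\<beta> (x, y)) (at x) \<and>
       ((\<lambda>t. \<phi> (x, t)) has_vector_derivative - a\<^sub>2 x y *\<^sub>R X\<^sub>\<beta> (x, y)) (at y) \<and>
       ((\<lambda>t. \<xi> (x, t)) has_vector_derivative b\<^sub>2 x y *\<^sub>R X\<^sub>\<beta> (x, y)) (at y) \<and>
       ((\<lambda>t. X\<^sub>\<alpha> (x, t)) has_vector_derivative c\<^sub>2 x y *\<^sub>R X\<^sub>\<beta> (x, y)) (at y) \<and>
       ((\<lambda>t. X\<^sub>\<beta> (x, t)) has_vector_derivative
          a\<^sub>2 x y *\<^sub>R \<phi> (x, y) - b\<^sub>2 x y *\<^sub>R \<xi> (x, y) - c\<^sub>2 x y *\<^sub>R X\<^sub>\<alpha> (x, y)) (at y))"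

definition curvature_surface ::
  "(real \<times> real \<Rightarrow> real ^ 4) \<Rightarrow> (real \<times> real \<Rightarrow> real ^ 4) \<Rightarrow>
   (real \<times> real \<Rightarrow> real ^ 4) \<Rightarrow> bool" where
  "curvature_surface X\<^sub>\<alpha> X\<^sub>\<beta> f \<longleftrightarrow>
     real_analytic_on f D \<and>
     (\<forall>(x, y) \<in> D.
       (f has_derivative
          (\<lambda>(dx, dy). ((x\<^sup>2 - y\<^sup>2) / (x * h x y) * dx) *\<^sub>R X\<^sub>\<alpha> (x, y)
                      + (2 * y / h x y * dy) *\<^sub>R X\<^sub>\<beta> (x, y))) (at (x, y)))"

text \<open>
  The defining expressions of the next two functions do not depend on \<open>y\<close>, and that of
  \<open>u_vec\<close> does not depend on \<open>x > 0\<close>; the functions denote the respective common value.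
\<close>

definition u_tilde ::
  "(real \<times> real \<Rightarrow> real ^ 4) \<Rightarrow> (real \<times> real \<Rightarrow> real ^ 4) \<Rightarrow> real \<Rightarrow> real ^ 4" where
  "u_tilde X\<^sub>\<alpha> \<xi> x =
     (THE v. \<forall>y. v = (1 / sqrt ((B\<^sub>2 x)\<^sup>2 + (C\<^sub>2 x)\<^sup>2))
                      *\<^sub>R (- B\<^sub>2 x *\<^sub>R X\<^sub>\<alpha> (x, y) + C\<^sub>2 x *\<^sub>R \<xi> (x, y)))"

definition A_tilde ::
  "(real \<times> real \<Rightarrow> real ^ 4) \<Rightarrow> (real \<times> real \<Rightarrow> real ^ 4) \<Rightarrow>
   (real \<times> real \<Rightarrow> real ^ 4) \<Rightarrow> real \<Rightarrow> real ^ 4" where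
  "A_tilde X\<^sub>\<alpha> \<xi> f x =
     (THE v. \<forall>y. v = f (x, y) - (1 / ((B\<^sub>2 x)\<^sup>2 + (C\<^sub>2 x)\<^sup>2))
                      *\<^sub>R (B\<^sub>2 x *\<^sub>R \<xi> (x, y) + C\<^sub>2 x *\<^sub>R X\<^sub>\<alpha> (x, y)))"

definition u_vec ::
  "(real \<times> real \<Rightarrow> real ^ 4) \<Rightarrow> (real \<times> real \<Rightarrow> real ^ 4) \<Rightarrow> real \<Rightarrow> real ^ 4" where
  "u_vec \<phi> X\<^sub>\<beta> y =
     (THE v. \<forall>x > 0. v = (1 / sqrt (1 + y\<^sup>2)) *\<^sub>R (y *\<^sub>R X\<^sub>\<beta> (x, y) - \<phi> (x, y)))"

definition is_bc_inf :: "(real \<times> real \<Rightarrow> real ^ 4) \<Rightarrow> real ^ 4 \<Rightarrow> real ^ 4 \<Rightarrow> bool" where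
  "is_bc_inf X\<^sub>\<alpha> b c \<longleftrightarrow>
     orthonormal [b, c] \<and>
     (\<forall>y. ((\<lambda>u. X\<^sub>\<alpha> (exp (- u), y)
                 - (cos (sqrt 5 * u / 2) *\<^sub>R b - sin (sqrt 5 * u / 2) *\<^sub>R c)) \<longlongrightarrow> 0) at_top)"

definition v1_vec :: "real ^ 4 \<Rightarrow> real ^ 4 \<Rightarrow> real \<Rightarrow> real ^ 4" where
  "v1_vec bt ct y = - cos (y - arctan y) *\<^sub>R bt - sin (y - arctan y) *\<^sub>R ct"

definition is_bc_tilde_inf ::
  "(real \<times> real \<Rightarrow> real ^ 4) \<Rightarrow> (real \<times> real \<Rightarrow> real ^ 4) \<Rightarrow> real ^ 4 \<Rightarrow> real ^ 4 \<Rightarrow> bool" where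
  "is_bc_tilde_inf \<phi> X\<^sub>\<beta> bt ct \<longleftrightarrow>
     orthonormal [bt, ct] \<and>
     (\<forall>y. u_vec \<phi> X\<^sub>\<beta> y = - sin (y - arctan y) *\<^sub>R bt + cos (y - arctan y) *\<^sub>R ct \<and>
          (u_vec \<phi> X\<^sub>\<beta> has_vector_derivative (y\<^sup>2 / (1 + y\<^sup>2)) *\<^sub>R v1_vec bt ct y) (at y))"

definition b_tilde :: "real ^ 4 \<Rightarrow> real ^ 4 \<Rightarrow> real \<Rightarrow> real ^ 4" where
  "b_tilde bt ct y = cos y *\<^sub>R bt + sin y *\<^sub>R ct"

text \<open>
  Sign: with the structure equations of \<open>frame_field\<close> and the normalisation of \<open>u_vec\<close> one has
  \<open>a\<^sub>2 x y \<rightarrow> 1\<close> as \<open>y \<rightarrow> \<infinity>\<close>, so \<open>\<phi>\<close> is asymptotic to \<open>c_tilde\<close> (the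
  \<open>y\<close>-derivative of \<open>b_tilde\<close>) and not to its negative.
\<close>

definition c_tilde :: "real ^ 4 \<Rightarrow> real ^ 4 \<Rightarrow> real \<Rightarrow> real ^ 4" where
  "c_tilde bt ct y = - sin y *\<^sub>R bt + cos y *\<^sub>R ct"

definition converges_uniformly :: "(real \<Rightarrow> real ^ 4) \<Rightarrow> (real \<Rightarrow> real ^ 4) \<Rightarrow> bool" where
  "converges_uniformly M N \<longleftrightarrow> (\<forall>\<epsilon> > 0. \<exists>R. \<forall>y > R. norm (M y - N y) < \<epsilon>)"

text \<open>Uniformity in the wider sense with respect to \<open>x \<in> (0, \<infinity>)\<close>.\<close>

definition converges_uniformly_wide ::
  "(real \<Rightarrow> real \<Rightarrow> real ^ 4) \<Rightarrow> (real \<Rightarrow> real \<Rightarrow> real ^ 4) \<Rightarrow> bool" where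
  "converges_uniformly_wide M N \<longleftrightarrow>
     (\<forall>K. compact K \<and> K \<subseteq> {0<..} \<longrightarrow>
       (\<forall>\<epsilon> > 0. \<exists>R. \<forall>x \<in> K. \<forall>y > R. norm (M x y - N x y) < \<epsilon>))"

end

(*
Put G = X0'/x, C = x G', B = -G/2 - sqrt 5, H = 2 X0 - x^2 G + sqrt 5, so that h = H + y^2 G.
The recursion for the coefficients is the equation x C' = X0 - 5/4 G - x^2 G, whose first integral
gives rho^2 := B^2 + C^2 = G (H - G) and hence G > 0 and H > G everywhere.

The unit vectors u = (-B Xa + C xi)/rho and w = (C Xa + B xi)/rho complete phi and Xb to an
orthonormal basis. In this basis u_x = T v with
  v = (2 rho/h) (y phi + Xb) + kappa w,   kappa = 1 - 2 (H - G)/h,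
and v_x = -T u, so (u, v) rotates in a fixed plane by the angle w_tilde; the behaviour as x -> 0
identifies that plane and the initial phase with (b, c).

Since f = A_tilde + w/rho, the distance from f to the limit point is |w - v|/rho = 2/sqrt(G h).
Similarly e = (y phi + Xb)/sqrt(1 + y^2) and v1_vec differ by 2 sqrt((H - G)/h), while Xb and phi
arise from u_vec and e by a rotation which tends to the identity as y -> infinity.
*)

theory Submission
  imports Defs
begin

text \<open>One angle lies behind both distance formulas. Since h = (1 + y^2) G + (H - G), the
  numbers kappa and 2 rho sqrt(1 + y^2) / h are cos theta and sin theta for the theta in (0, pi)
  with tan(theta/2)^2 = (H - G) / ((1 + y^2) G). Then v = cos theta w + sin theta e, while
  \<open>v1_vec\<close> = cos theta e - sin theta w for y \<noteq> 0. The pair (v,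
  \<open>v1_vec\<close>) is thus (w, e) turned by theta, and theta tends to 0 like 1/y, locally
  uniformly in x. The formula v_x = - T u is never checked for general y: as u does not depend on y
  and T > 0, neither does v, so the line y = 0 suffices, where \<open>a\<^sub>1\<close> vanishes.
  The phase is fixed in the limit x -> 0, where X0'/x is undefined. Hence G and C are introduced as
  power series in x^2, which makes them, and with them B, H and rho, differentiable at 0.\<close>

section \<open>The profile function\<close>

text \<open>The prescribed value 1 of the second coefficient is what the recursion yields at k = 0
  from 5/2, so one formula covers all indices.\<close>

lemma X0_coeff_Suc:
  "X0_coeff (Suc k) = - ((2 * real k - 1) * X0_coeff k) / (2 * (real k + 1) * (4 * (real k)\<^sup>2 + 5 / 4))"
  by (cases k) (auto simp: Let_def)

text \<open>The quotient of consecutive coefficients is at most 1/(k + 1) in absolute value. This is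
  far from sharp, but enough for comparison with the exponential series; 5/2 is the coefficient at
  0.\<close>

lemma abs_X0_coeff_le: "\<bar>X0_coeff k\<bar> \<le> 5 / 2 / fact k"
proof (induction k)
  case (Suc k)
  have pos: "0 < 4 * (real k)\<^sup>2 + 5 / 4"
    by (simp add: add_nonneg_pos)
  have "\<bar>2 * r - 1\<bar> \<le> 2 * (4 * r\<^sup>2 + 5 / 4)" if "0 \<le> r" for r :: real
  proof -
    have "0 \<le> r\<^sup>2 - 2 * r + 1"
      using zero_le_power2[of "r - 1"] by (simp add: power2_diff)
    then show ?thesis
      using that zero_le_power2[of r] by argo
  qed
  from this[of "real k"] have num: "\<bar>2 * real k - 1\<bar> \<le> 2 * (4 * (real k)\<^sup>2 + 5 / 4)"
    by simp
  have "\<bar>X0_coeff (Suc k)\<bar> = \<bar>2 * real k - 1\<bar> / (2 * (4 * (real k)\<^sup>2 + 5 / 4)) * (\<bar>X0_coeff k\<bar> / (real k + 1))"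
    using pos by (simp add: X0_coeff_Suc abs_mult) (simp add: algebra_simps)
  also have "\<dots> \<le> 1 * (\<bar>X0_coeff k\<bar> / (real k + 1))"
    using num pos by (intro mult_right_mono) (auto simp: divide_le_eq)
  also have "\<dots> \<le> 5 / 2 / fact k / (real k + 1)"
    using divide_right_mono[OF Suc.IH, of "real k + 1"] by simp
  also have "\<dots> = 5 / 2 / fact (Suc k)"
    by (simp add: field_simps)
  finally show ?case .
qed auto

lemma summable_X0_coeff: "summable (\<lambda>k. X0_coeff k * t ^ k)"
proof (rule summable_comparison_test)
  have "summable (\<lambda>k. 5 / 2 * (inverse (fact k) * \<bar>t\<bar> ^ k))"
    by (intro summable_mult) (rule summable_exp)
  then show "summable (\<lambda>k. 5 / 2 / fact k * \<bar>t\<bar> ^ k)"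
    by (simp add: field_simps)
  show "\<exists>N. \<forall>k\<ge>N. norm (X0_coeff k * t ^ k) \<le> 5 / 2 / fact k * \<bar>t\<bar> ^ k"
    unfolding real_norm_def abs_mult power_abs by (intro exI allI impI mult_right_mono abs_X0_coeff_le) simp
qed

text \<open>This is the Euler operator t d/dt: it multiplies the k-th coefficient by k without
  shifting the powers, so that differential equations can be compared coefficientwise.\<close>

lemma sums_of_nat_mult:
  fixes c :: "nat \<Rightarrow> real"
  assumes "\<And>t. summable (\<lambda>k. c k * t ^ k)"
  shows "(\<lambda>k. real k * c k * t ^ k) sums (t * (\<Sum>k. diffs c k * t ^ k))"
proof -
  have "(\<lambda>k. real k * c k * t ^ (k - Suc 0)) sums (\<Sum>k. diffs c k * t ^ k)"
    using diffs_equiv[OF termdiff_converges_all[OF assms]] by simp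
  from sums_mult[OF this, of t] show ?thesis
    by (rule sums_cong[THEN iffD1, rotated]) (auto split: nat.split simp: gr0_conv_Suc power_eq_if)
qed

text \<open>Writing X0(x) = F(x^2), this is 2 F'(x^2), the analytic continuation of X0'/x to x = 0;
  \<open>C\<close> below is 4 t F''(t) at t = x^2.\<close>

definition G :: "real \<Rightarrow> real" where
  "G x = 2 * (\<Sum>k. diffs X0_coeff k * (x\<^sup>2) ^ k)"

definition C :: "real \<Rightarrow> real" where
  "C x = 4 * (\<Sum>k. real k * diffs X0_coeff k * (x\<^sup>2) ^ k)"

abbreviation "G' \<equiv> deriv G"
abbreviation "C' \<equiv> deriv C"

lemma summable_diffs_X0_coeff: "summable (\<lambda>k. diffs X0_coeff k * t ^ k)"
  by (rule termdiff_converges_all[OF summable_X0_coeff])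

lemma summable_of_nat_diffs_X0_coeff: "summable (\<lambda>k. real k * diffs X0_coeff k * t ^ k)"
  by (rule sums_summable[OF sums_of_nat_mult[OF summable_diffs_X0_coeff]])

lemma DERIV_powser_square:
  fixes c :: "nat \<Rightarrow> real"
  assumes "\<And>t. summable (\<lambda>k. c k * t ^ k)"
  shows "((\<lambda>x. \<Sum>k. c k * (x\<^sup>2) ^ k) has_real_derivative 2 * x * (\<Sum>k. diffs c k * (x\<^sup>2) ^ k)) (at x)"
proof -
  have "((\<lambda>t. \<Sum>k. c k * t ^ k) has_real_derivative (\<Sum>k. diffs c k * (x\<^sup>2) ^ k)) (at (x\<^sup>2))"
    using termdiffs_strong_converges_everywhere[of c] assms by auto
  moreover have "((\<lambda>x. x\<^sup>2) has_real_derivative 2 * x) (at x)"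
    by (auto intro!: derivative_eq_intros)
  ultimately have "((\<lambda>x. \<Sum>k. c k * (x\<^sup>2) ^ k) has_real_derivative
      (\<Sum>k. diffs c k * (x\<^sup>2) ^ k) * (2 * x)) (at x)"
    by (rule DERIV_chain2[where f = "\<lambda>t. \<Sum>k. c k * t ^ k" and g = "\<lambda>x. x\<^sup>2"])
  then show ?thesis
    by (simp add: mult_ac)
qed

lemma DERIV_X0: "(X0 has_real_derivative x * G x) (at x)"
  unfolding X0_def[abs_def] power_mult G_def
  by (rule DERIV_cong[OF DERIV_powser_square[OF summable_X0_coeff]]) simp

lemma DERIV_G: "(G has_real_derivative G' x) (at x)"
  and mult_G': "x * G' x = C x"
proof -
  let ?S = "\<Sum>k. diffs (diffs X0_coeff) k * (x\<^sup>2) ^ k"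
  have *: "(G has_real_derivative 2 * (2 * x * ?S)) (at x)"
    unfolding G_def[abs_def]
    by (rule DERIV_cmult[OF DERIV_powser_square[OF summable_diffs_X0_coeff]])
  then show "(G has_real_derivative G' x) (at x)"
    by (metis DERIV_imp_deriv)
  show "x * G' x = C x"
    using DERIV_imp_deriv[OF *] sums_unique[OF sums_of_nat_mult[OF summable_diffs_X0_coeff], of "x\<^sup>2"]
    by (simp add: C_def power2_eq_square)
qed

lemma DERIV_C: "(C has_real_derivative C' x) (at x)"
  and mult_C': "x * C' x = X0 x - 5 / 4 * G x - x\<^sup>2 * G x"
proof -
  let ?d = "diffs X0_coeff"
  let ?S = "\<Sum>k. diffs (\<lambda>k. real k * ?d k) k * (x\<^sup>2) ^ k"
  have *: "(C has_real_derivative 4 * (2 * x * ?S)) (at x)"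
    unfolding C_def[abs_def]
    by (rule DERIV_cmult[OF DERIV_powser_square[OF summable_of_nat_diffs_X0_coeff]])
  then show "(C has_real_derivative C' x) (at x)"
    by (metis DERIV_imp_deriv)
  define t where "t = x\<^sup>2"
  have 1: "(\<lambda>k. 8 * (real k * (real k * ?d k) * t ^ k)) sums (x * C' x)"
    using sums_mult[OF sums_of_nat_mult[OF summable_of_nat_diffs_X0_coeff], of 8 t] DERIV_imp_deriv[OF *]
    by (simp add: t_def power2_eq_square mult_ac)
  have 2: "(\<lambda>k. 5 / 2 * (?d k * t ^ k)) sums (5 / 4 * G x)"
    using sums_mult[OF summable_sums[OF summable_diffs_X0_coeff], of "5/2" t] by (simp add: G_def t_def)
  have 3: "(\<lambda>k. 2 * (real k * X0_coeff k * t ^ k)) sums (x\<^sup>2 * G x)"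
    using sums_mult[OF sums_of_nat_mult[OF summable_X0_coeff], of 2 t] by (simp add: G_def t_def mult_ac)
  have "(\<lambda>k. 8 * (real k * (real k * ?d k) * t ^ k) + 5 / 2 * (?d k * t ^ k) +
      2 * (real k * X0_coeff k * t ^ k)) sums (x * C' x + 5 / 4 * G x + x\<^sup>2 * G x)"
    by (intro sums_add 1 2 3)
  \<comment> \<open>As \<open>?d k\<close> is k + 1 times the next coefficient, the recursion reads
    (8 k^2 + 5/2) \<open>?d k\<close> + 2 k \<open>X0_coeff k\<close> =
    \<open>X0_coeff k\<close>.\<close>
  moreover have "8 * (real k * (real k * ?d k) * t ^ k) + 5 / 2 * (?d k * t ^ k) +
      2 * (real k * X0_coeff k * t ^ k) = X0_coeff k * t ^ k" for k
  proof -
    have "0 < 4 * (real k)\<^sup>2 + 5 / 4" "real k + 1 > 0"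
      by (simp_all add: add_nonneg_pos)
    then have "?d k * (2 * (4 * (real k)\<^sup>2 + 5 / 4)) = - ((2 * real k - 1) * X0_coeff k)"
      by (simp add: diffs_def X0_coeff_Suc del: X0_coeff.simps) (simp add: divide_simps)
    then have "(8 * (real k * (real k * ?d k)) + 5 / 2 * ?d k + 2 * (real k * X0_coeff k)) * t ^ k
        = X0_coeff k * t ^ k"
      by (intro arg_cong2[of _ _ _ _ "(*)"]) (auto simp: algebra_simps power2_eq_square)
    then show ?thesis by (simp add: algebra_simps)
  qed
  moreover have "(\<lambda>k. X0_coeff k * t ^ k) sums X0 x"
    using summable_sums[OF summable_X0_coeff, of t] by (simp add: X0_def t_def power_mult)
  ultimately have "x * C' x + 5 / 4 * G x + x\<^sup>2 * G x = X0 x"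
    using sums_unique2 by force
  then show "x * C' x = X0 x - 5 / 4 * G x - x\<^sup>2 * G x" by simp
qed

lemma X0_0: "X0 0 = 5 / 2" and G_0: "G 0 = 2" and C_0: "C 0 = 0"
  by (simp_all only: X0_def G_def C_def power_mult zero_power2 powser_zero) (simp_all add: diffs_def)

lemma G'_0: "G' 0 = 0"
  by (auto intro!: DERIV_imp_deriv DERIV_cong[OF DERIV_cmult[OF DERIV_powser_square]]
      simp: G_def[abs_def] summable_diffs_X0_coeff)

section \<open>The first integral and the structure functions\<close>

definition B :: "real \<Rightarrow> real" where
  "B x = - G x / 2 - sqrt 5"

definition P :: "real \<Rightarrow> real" where
  "P x = X0 x + sqrt 5 / 2"

definition H :: "real \<Rightarrow> real" where
  "H x = 2 * X0 x - x\<^sup>2 * G x + sqrt 5"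

definition \<rho> :: "real \<Rightarrow> real" where
  "\<rho> x = sqrt ((B x)\<^sup>2 + (C x)\<^sup>2)"

text \<open>Multiplying the equation for x C' by G' and using x G' = C turns its left side into C
  C'; the right side integrates, because the terms 2 x G^2 from 2 G X0 and from x^2 G^2 cancel. The
  constant is the value at 0: - 2 * 2 * 5/2 + 5/4 * 4 = -5.\<close>

lemma first_integral: "(C x)\<^sup>2 = 2 * G x * X0 x - 5 / 4 * (G x)\<^sup>2 - x\<^sup>2 * (G x)\<^sup>2 - 5"
proof -
  define E where "E = (\<lambda>x. (C x)\<^sup>2 - 2 * G x * X0 x + 5 / 4 * (G x)\<^sup>2 + x\<^sup>2 * (G x)\<^sup>2)"
  have "(E has_real_derivative 0) (at t)" for t
  proof (rule DERIV_cong)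
    show "(E has_real_derivative 2 * C t * C' t - (2 * G t * (t * G t) + 2 * G' t * X0 t) +
        5 / 2 * G t * G' t + (t\<^sup>2 * (2 * G t * G' t) + 2 * t * (G t)\<^sup>2)) (at t)"
      unfolding E_def
      by (rule derivative_eq_intros DERIV_X0 DERIV_G DERIV_C refl)+ (simp add: mult_ac)
    \<comment> \<open>No division by t occurs, so the point t = 0 is included.\<close>
    have "C t * C' t = G' t * (X0 t - 5 / 4 * G t - t\<^sup>2 * G t)"
      unfolding mult_C'[symmetric] mult_G'[symmetric] by simp
    then show "2 * C t * C' t - (2 * G t * (t * G t) + 2 * G' t * X0 t) +
        5 / 2 * G t * G' t + (t\<^sup>2 * (2 * G t * G' t) + 2 * t * (G t)\<^sup>2) = 0"
      by (simp add: algebra_simps power2_eq_square)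
  qed
  then have "E x = E 0"
    using DERIV_isconst_all by blast
  then show ?thesis
    by (simp add: E_def X0_0 G_0 C_0)
qed

text \<open>At a zero of G the first integral would give C^2 = -5; by continuity G keeps the sign of
  G 0 = 2.\<close>

lemma G_pos: "0 < G x"
proof -
  have nz: "G t \<noteq> 0" for t
  proof
    assume "G t = 0"
    with first_integral[of t] have "(C t)\<^sup>2 = - 5" by simp
    then show False using zero_le_power2[of "C t"] by simp
  qed
  have "continuous_on UNIV G"
    using DERIV_G by (meson DERIV_continuous_on has_field_derivative_at_within)
  then have "connected (range G)"
    by (rule connected_continuous_image) simp
  then have "0 \<in> range G" if "G x \<le> 0"
    using that G_0 unfolding connected_iff_interval by (metis rangeI zero_le_numeral)
  then show ?thesis
    using nz by (metis imageE linorder_not_less)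
qed

text \<open>Solved for its terms divisible by G, the first integral says that G times 2 X0 - 5/4 G -
  x^2 G equals C^2 + 5, and H - G exceeds that second factor.\<close>

lemma H_minus_G_pos: "0 < H x - G x"
proof -
  have "G x * (2 * X0 x - 5 / 4 * G x - x\<^sup>2 * G x) = (C x)\<^sup>2 + 5"
    using first_integral[of x] by (simp add: algebra_simps power2_eq_square)
  also have "\<dots> > 0" by (simp add: add_nonneg_pos)
  finally have "0 < 2 * X0 x - 5 / 4 * G x - x\<^sup>2 * G x"
    using G_pos[of x] zero_less_mult_pos by blast
  then have "0 < 2 * X0 x - x\<^sup>2 * G x - G x"
    using G_pos[of x] by simp
  then show ?thesis
    using real_sqrt_ge_zero[of 5] unfolding H_def by linarith
qed

lemma H_pos: "0 < H x"
  using H_minus_G_pos[of x] G_pos[of x] by simp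

text \<open>The square of sqrt 5 in B^2 cancels the constant -5 of the first integral, and the
  remainder is divisible by G.\<close>

lemma sum_squares_BC: "(B x)\<^sup>2 + (C x)\<^sup>2 = G x * (H x - G x)"
proof -
  have "sqrt 5 * sqrt 5 = (5::real)" by simp
  then show ?thesis
    unfolding first_integral B_def H_def by (simp add: algebra_simps power2_eq_square)
qed

lemma rho_pos: "0 < \<rho> x"
  using G_pos[of x] H_minus_G_pos[of x] by (simp add: \<rho>_def sum_squares_BC)

lemma rho_square: "(\<rho> x)\<^sup>2 = (B x)\<^sup>2 + (C x)\<^sup>2"
  by (simp add: \<rho>_def)

lemma H_eq_P: "H x = 2 * P x - x\<^sup>2 * G x"
  by (simp add: H_def P_def)

lemma B_neg: "B x < 0"
  using G_pos[of x] real_sqrt_ge_zero[of 5] unfolding B_def by linarith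

lemma P_pos: "0 < P x"
  using H_pos[of x] G_pos[of x] mult_nonneg_nonneg[of "x\<^sup>2" "G x"] unfolding H_eq_P
  by (smt (verit) zero_le_power2)

section \<open>The given coefficient functions in terms of G, C, B, H and P\<close>

lemma deriv_X0: "X0' x = x * G x"
  by (rule DERIV_imp_deriv) (rule DERIV_X0)

lemma deriv2_X0: "X0'' x = G x + C x"
proof -
  have "((\<lambda>x. x * G x) has_real_derivative G x + x * G' x) (at x)"
    by (rule derivative_eq_intros DERIV_G refl)+ simp
  then show ?thesis
    by (auto simp: mult_G' deriv_X0[abs_def] intro: DERIV_imp_deriv)
qed

lemma B\<^sub>2_eq: "x \<noteq> 0 \<Longrightarrow> B\<^sub>2 x = B x"
  by (simp add: B\<^sub>2_def B_def deriv_X0)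

lemma C\<^sub>2_eq: "x \<noteq> 0 \<Longrightarrow> C\<^sub>2 x = C x"
  by (simp add: C\<^sub>2_def deriv2_X0 deriv_X0)

lemma h_eq: "x \<noteq> 0 \<Longrightarrow> h x y = H x + y\<^sup>2 * G x"
  by (simp add: h_def H_def deriv_X0 power2_eq_square)

lemma h_pos: "x \<noteq> 0 \<Longrightarrow> 0 < h x y"
  using H_pos[of x] G_pos[of x] by (simp add: h_eq add_pos_nonneg)

lemma h_ge: "x \<noteq> 0 \<Longrightarrow> y\<^sup>2 * G x \<le> h x y"
  using H_pos[of x] by (simp add: h_eq)

text \<open>The denominator of \<open>T\<close> is 4 x^2 G (H - G) = 4 x^2 rho^2, so
  \<open>T\<close> is singular at 0 only.\<close>

lemma T_eq:
  assumes "x \<noteq> 0"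
  shows "T x = - B x * P x / (x * (\<rho> x)\<^sup>2)"
proof -
  have "T x = (x * (- 2 * B x) * (2 * P x)) / (4 * x * (x * G x) * (H x - G x))"
    using assms by (simp add: T_def deriv_X0 B_def P_def H_def algebra_simps power2_eq_square)
  then show ?thesis
    using assms G_pos[of x] H_minus_G_pos[of x]
    by (simp add: rho_square sum_squares_BC)
qed

lemma T_pos: "0 < x \<Longrightarrow> 0 < T x"
  using rho_pos[of x] B_neg[of x] P_pos[of x] by (simp add: T_eq mult_neg_pos divide_neg_pos)

lemma structure_coefficients:
  assumes "x \<noteq> 0"
  shows "a\<^sub>1 x y = 2 * y * P x / (x * h x y)"
    and "b\<^sub>1 x y = - (P x + sqrt 5 * (x\<^sup>2 - y\<^sup>2)) / (x * h x y)"
    and "c\<^sub>1 x y = - (2 * P x) / (x * h x y)"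
    and "a\<^sub>2 x y = (y\<^sup>2 * G x - H x) / h x y"
    and "b\<^sub>2 x y = 2 * y / h x y * B x"
    and "c\<^sub>2 x y = 2 * y / h x y * C x"
proof -
  show "a\<^sub>1 x y = 2 * y * P x / (x * h x y)"
    by (simp add: a\<^sub>1_def P_def)
  show "b\<^sub>1 x y = - (P x + sqrt 5 * (x\<^sup>2 - y\<^sup>2)) / (x * h x y)"
    unfolding b\<^sub>1_def P_def by (simp only: minus_divide_left mult_minus_left times_divide_eq_left mult_1)
  show "c\<^sub>1 x y = - (2 * P x) / (x * h x y)"
    by (simp add: c\<^sub>1_def flip: P_def)
  have "2 * X0 x + sqrt 5 - (x\<^sup>2 + y\<^sup>2) * (X0' x / x) = - (y\<^sup>2 * G x - H x)"
    using assms by (simp add: deriv_X0 H_def distrib_right)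
  then show "a\<^sub>2 x y = (y\<^sup>2 * G x - H x) / h x y"
    unfolding a\<^sub>2_def by (simp only: minus_mult_minus times_divide_eq_left mult_1)
  have "X0' x / (2 * x) + sqrt 5 = - B x"
    using assms by (simp add: deriv_X0 B_def)
  then show "b\<^sub>2 x y = 2 * y / h x y * B x"
    unfolding b\<^sub>2_def by simp
  show "c\<^sub>2 x y = 2 * y / h x y * C x"
    using assms by (simp add: c\<^sub>2_def deriv_X0 deriv2_X0)
qed

section \<open>Derivatives of the normalized structure functions\<close>

definition \<psi>' :: "real \<Rightarrow> real" where
  "\<psi>' x = (sqrt 5 * (H x - G x) + P x * B x) / (x * (\<rho> x)\<^sup>2)"

lemma DERIV_H: "(H has_real_derivative - x * C x) (at x)"
  unfolding H_def[abs_def] mult_G'[symmetric]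
  by (rule derivative_eq_intros DERIV_X0 DERIV_G refl)+ (simp add: power2_eq_square)

lemma DERIV_B: "(B has_real_derivative - G' x / 2) (at x)"
  unfolding B_def[abs_def] by (auto intro!: derivative_eq_intros DERIV_G)

lemma DERIV_rho: "(\<rho> has_real_derivative (C x * C' x - B x * G' x / 2) / \<rho> x) (at x)"
proof -
  have pos: "0 < (B x)\<^sup>2 + (C x)\<^sup>2"
    using rho_pos[of x] by (simp add: \<rho>_def)
  have "((\<lambda>x. (B x)\<^sup>2 + (C x)\<^sup>2) has_real_derivative 2 * (C x * C' x - B x * G' x / 2)) (at x)"
    by (auto intro!: derivative_eq_intros DERIV_B DERIV_C)
  from DERIV_chain2[where f = sqrt, OF DERIV_real_sqrt[OF pos] this] show ?thesis
    unfolding \<rho>_def[abs_def] by (auto elim!: DERIV_cong simp: divide_simps)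
qed

text \<open>The right side is the cross product of (-B, C) with its derivative, hence rho^2 times
  the angular velocity of that vector. The differential equation for C and the first integral remove
  all derivatives, which leaves the closed form of \<open>\<psi>'\<close>.\<close>

lemma psi_eq:
  assumes "x \<noteq> 0"
  shows "\<psi>' x * (\<rho> x)\<^sup>2 = - (G' x * C x / 2 + B x * C' x)"
proof -
  have "sqrt 5 * sqrt 5 = (5::real)" by simp
  then have "sqrt 5 * (H x - G x) + P x * B x =
      - ((C x)\<^sup>2 / 2 + B x * (X0 x - 5 / 4 * G x - x\<^sup>2 * G x))"
    unfolding first_integral B_def H_def P_def by (simp add: field_simps power2_eq_square)
  also have "\<dots> = - ((x * G' x) * C x / 2 + B x * (x * C' x))"
    unfolding mult_C' mult_G' by (simp add: power2_eq_square)
  also have "\<dots> = - x * (G' x * C x / 2 + B x * C' x)"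
    by (simp add: algebra_simps)
  finally show ?thesis
    using assms rho_pos[of x] by (simp add: \<psi>'_def divide_simps)
qed

lemma DERIV_BC_normalized:
  assumes "x \<noteq> 0"
  shows "((\<lambda>x. - B x / \<rho> x) has_real_derivative - (C x / \<rho> x) * \<psi>' x) (at x)"
    and "((\<lambda>x. C x / \<rho> x) has_real_derivative - (B x / \<rho> x) * \<psi>' x) (at x)"
proof -
  have nz: "\<rho> x \<noteq> 0" using rho_pos[of x] by simp
  have "(G' x / 2 * \<rho> x + B x * ((C x * C' x - B x * G' x / 2) / \<rho> x)) * \<rho> x
      = G' x / 2 * (\<rho> x)\<^sup>2 + B x * (C x * C' x - B x * G' x / 2)"
    using nz by (simp add: distrib_right power2_eq_square)
  also have "\<dots> = - C x * (\<psi>' x * (\<rho> x)\<^sup>2)"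
    unfolding psi_eq[OF assms] unfolding rho_square by (simp add: algebra_simps power2_eq_square)
  finally have "G' x / 2 * \<rho> x + B x * ((C x * C' x - B x * G' x / 2) / \<rho> x) = - C x * \<psi>' x * \<rho> x"
    using nz by (metis (no_types) mult.assoc mult_right_cancel power2_eq_square)
  moreover have "((\<lambda>x. - B x / \<rho> x) has_real_derivative (G' x / 2 * \<rho> x + B x * ((C x * C' x - B x * G' x / 2) / \<rho> x)) / (\<rho> x * \<rho> x)) (at x)"
    by (rule derivative_eq_intros DERIV_B DERIV_rho refl nz)+ simp
  ultimately show "((\<lambda>x. - B x / \<rho> x) has_real_derivative - (C x / \<rho> x) * \<psi>' x) (at x)"
    using nz by simp
  have "(C' x * \<rho> x - C x * ((C x * C' x - B x * G' x / 2) / \<rho> x)) * \<rho> x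
      = C' x * (\<rho> x)\<^sup>2 - C x * (C x * C' x - B x * G' x / 2)"
    using nz by (simp add: left_diff_distrib power2_eq_square)
  also have "\<dots> = - B x * (\<psi>' x * (\<rho> x)\<^sup>2)"
    unfolding psi_eq[OF assms] unfolding rho_square by (simp add: algebra_simps power2_eq_square)
  finally have "C' x * \<rho> x - C x * ((C x * C' x - B x * G' x / 2) / \<rho> x) = - B x * \<psi>' x * \<rho> x"
    using nz by (metis (no_types) mult.assoc mult_right_cancel power2_eq_square)
  moreover have "((\<lambda>x. C x / \<rho> x) has_real_derivative (C' x * \<rho> x - C x * ((C x * C' x - B x * G' x / 2) / \<rho> x)) / (\<rho> x * \<rho> x)) (at x)"
    by (rule derivative_eq_intros DERIV_C DERIV_rho refl nz)+
  ultimately show "((\<lambda>x. C x / \<rho> x) has_real_derivative - (B x / \<rho> x) * \<psi>' x) (at x)"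
    using nz by simp
qed

text \<open>For y = 0 the vector \<open>v\<close> defined below has the coefficients 2 rho / H and
  (2 G - H) / H; this lemma and the next differentiate them. Taking the root of G (H - G) instead of
  B^2 + C^2 keeps C' out of the result.\<close>

lemma DERIV_rho_H:
  assumes "x \<noteq> 0"
  shows "((\<lambda>x. 2 * \<rho> x / H x) has_real_derivative
           2 * P x * C x * (H x - 2 * G x) / (x * \<rho> x * (H x)\<^sup>2)) (at x)"
proof (rule DERIV_cong)
  have *: "\<rho> = (\<lambda>x. sqrt (G x * (H x - G x)))"
    by (auto simp: \<rho>_def sum_squares_BC)
  have pos: "0 < G x * (H x - G x)"
    using G_pos[of x] H_minus_G_pos[of x] by simp
  have "(\<rho> has_real_derivative (G' x * (H x - G x) + G x * (- x * C x - G' x)) / (2 * \<rho> x)) (at x)"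
    unfolding *
    using DERIV_chain2[where f = sqrt, OF DERIV_real_sqrt[OF pos] DERIV_mult[OF DERIV_G DERIV_diff[OF DERIV_H DERIV_G]]]
    by (simp add: divide_simps mult_ac)
  then show "((\<lambda>x. 2 * \<rho> x / H x) has_real_derivative
      (2 * ((G' x * (H x - G x) + G x * (- x * C x - G' x)) / (2 * \<rho> x)) * H x - 2 * \<rho> x * (- x * C x)) / (H x * H x)) (at x)"
    using H_pos[of x] by (auto intro!: derivative_eq_intros DERIV_H)
  have "(2 * ((G' x * (H x - G x) + G x * (- x * C x - G' x)) / (2 * \<rho> x)) * H x - 2 * \<rho> x * (- x * C x)) * (x * \<rho> x)
     = x * (G' x * (H x - G x) + G x * (- x * C x - G' x)) * H x + 2 * x\<^sup>2 * C x * (\<rho> x)\<^sup>2"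
    using rho_pos[of x] unfolding left_diff_distrib[of "2 * _ * H x"] by (simp add: power2_eq_square)
  also have "\<dots> = (x * G' x) * (H x - 2 * G x) * H x - x\<^sup>2 * G x * C x * H x + 2 * x\<^sup>2 * C x * (G x * (H x - G x))"
    unfolding rho_square sum_squares_BC by (simp add: algebra_simps power2_eq_square)
  also have "\<dots> = 2 * P x * C x * (H x - 2 * G x)"
    unfolding mult_G' H_eq_P by (simp add: algebra_simps power2_eq_square)
  finally show "(2 * ((G' x * (H x - G x) + G x * (- x * C x - G' x)) / (2 * \<rho> x)) * H x - 2 * \<rho> x * (- x * C x)) / (H x * H x)
     = 2 * P x * C x * (H x - 2 * G x) / (x * \<rho> x * (H x)\<^sup>2)"
    using rho_pos[of x] H_pos[of x] assms by (simp add: divide_simps power2_eq_square)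
qed

lemma DERIV_G_H:
  assumes "x \<noteq> 0"
  shows "((\<lambda>x. (2 * G x - H x) / H x) has_real_derivative 4 * P x * C x / (x * (H x)\<^sup>2)) (at x)"
proof (rule DERIV_cong)
  show "((\<lambda>x. (2 * G x - H x) / H x) has_real_derivative
     ((2 * G' x + x * C x) * H x + (2 * G x - H x) * (x * C x)) / (H x * H x)) (at x)"
    using H_pos[of x] by (auto intro!: derivative_eq_intros DERIV_H DERIV_G)
  have "((2 * G' x + x * C x) * H x + (2 * G x - H x) * (x * C x)) * x =
      2 * (x * G' x) * H x + 2 * x\<^sup>2 * G x * C x"
    by (simp add: algebra_simps power2_eq_square)
  also have "\<dots> = 4 * P x * C x"
    unfolding mult_G' H_eq_P by (simp add: algebra_simps)
  finally show "((2 * G' x + x * C x) * H x + (2 * G x - H x) * (x * C x)) / (H x * H x) =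
      4 * P x * C x / (x * (H x)\<^sup>2)"
    using H_pos[of x] assms by (simp add: divide_simps power2_eq_square)
qed

section \<open>The angle function near the origin\<close>

text \<open>T = R / s with R differentiable everywhere, R 0 = sqrt 5 / 2, and derivative 0 at 0.
  Hence at the origin the function is the difference quotient of R, which tends to 0.\<close>

lemma isCont_T_minus_pole: "isCont (\<lambda>s. T s - sqrt 5 / (2 * s)) x"
proof -
  define R where "R = (\<lambda>s. - B s * P s / (\<rho> s)\<^sup>2)"
  have T_R: "T s = R s / s" if "s \<noteq> 0" for s
    using T_eq[OF that] by (simp add: R_def)
  have nz: "(\<rho> s)\<^sup>2 \<noteq> 0" for s
    using rho_pos[of s] by simp
  have P: "(P has_real_derivative s * G s) (at s)" for s
    unfolding P_def[abs_def] by (auto intro!: derivative_eq_intros DERIV_X0)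
  show ?thesis
  proof (cases "x = 0")
    case True
    define z where "z = sqrt 5 + (1::real)"
    have B0: "B 0 = - z"
      by (simp add: z_def B_def G_0)
    have P0: "P 0 = sqrt 5 / 2 * z"
      by (simp add: z_def P_def X0_0 algebra_simps)
    have rho0: "(\<rho> 0)\<^sup>2 = z\<^sup>2"
      unfolding rho_square C_0 B0 by simp
    have "0 < z"
      by (simp add: z_def add_nonneg_pos)
    then have R0: "R 0 = sqrt 5 / 2"
      unfolding R_def B0 P0 rho0 by (simp add: power2_eq_square)
    have "(R has_real_derivative 0) (at 0)"
      unfolding R_def
      by (rule derivative_eq_intros DERIV_B P DERIV_rho refl nz)+ (simp add: G'_0 C_0)
    then have "((\<lambda>s. (R s - R 0) / (s - 0)) \<longlongrightarrow> 0) (at 0)"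
      by (simp add: has_field_derivative_iff)
    moreover have "\<forall>\<^sub>F s in at 0. (R s - R 0) / (s - 0) = T s - sqrt 5 / (2 * s)"
      by (auto simp: eventually_at_filter T_R R0 diff_divide_distrib)
    ultimately have "((\<lambda>s. T s - sqrt 5 / (2 * s)) \<longlongrightarrow> 0) (at 0)"
      by (rule Lim_transform_eventually)
    \<comment> \<open>Division by 0 yields 0, so the value of the function at 0 is 0 as well and
      agrees with the limit.\<close>
    then show ?thesis
      using True by (simp add: isCont_def T_def)
  next
    case False
    have cont: "isCont (\<lambda>s. R s / s - sqrt 5 / (2 * s)) x"
      unfolding R_def using False nz
      by (intro continuous_intros DERIV_isCont[OF DERIV_B] DERIV_isCont[OF P] DERIV_isCont[OF DERIV_rho]) auto
    have "\<forall>\<^sub>F s in nhds x. R s / s - sqrt 5 / (2 * s) = T s - sqrt 5 / (2 * s)"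
      using t1_space_nhds[OF False] by eventually_elim (simp add: T_R)
    from isCont_cong[OF this] cont show ?thesis
      by blast
  qed
qed

lemma DERIV_w_tilde:
  assumes "0 < x"
  shows "(w_tilde has_real_derivative T x) (at x)"
proof -
  let ?f = "\<lambda>s. T s - sqrt 5 / (2 * s)"
  \<comment> \<open>The interval extends beyond x, so that x is interior and the derivative is
    two-sided.\<close>
  have "((\<lambda>x. integral {0..x} ?f) has_real_derivative ?f x) (at x within {0..x + 1})"
    using assms by (intro integral_has_real_derivative continuous_at_imp_continuous_on)
      (auto simp: isCont_T_minus_pole)
  moreover have "at x within {0..x + 1} = at x"
    using assms by (intro at_within_interior) auto
  ultimately have "((\<lambda>x. integral {0..x} ?f) has_real_derivative ?f x) (at x)"
    by simp
  then show ?thesis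
    unfolding w_tilde_def[abs_def] using assms
    by (auto intro!: derivative_eq_intros simp: field_simps)
qed

text \<open>At exp (- t) the logarithmic term is exactly - sqrt 5 / 2 * t; what remains is an
  integral of a continuous function over a shrinking interval.\<close>

lemma w_tilde_asymptotics: "((\<lambda>t. w_tilde (exp (- t)) + sqrt 5 / 2 * t) \<longlongrightarrow> 0) at_top"
proof -
  let ?f = "\<lambda>s. T s - sqrt 5 / (2 * s)"
  have "continuous_on {0..1} (\<lambda>x. integral {0..x} ?f)"
    by (intro indefinite_integral_continuous_1 integrable_continuous_interval
        continuous_at_imp_continuous_on) (auto simp: isCont_T_minus_pole)
  then have "((\<lambda>x. integral {0..x} ?f) \<longlongrightarrow> integral {0..0} ?f) (at 0 within {0..1})"
    unfolding continuous_on_def by (rule bspec) simp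
  moreover have "filterlim (\<lambda>t. exp (- t)) (at 0 within {0..1}) (at_top :: real filter)"
    unfolding filterlim_at
    by (auto intro!: exI[of _ 0] filterlim_compose[OF exp_at_bot] filterlim_uminus_at_bot_at_top
        eventually_mono[OF eventually_ge_at_top[of "0::real"]])
  ultimately have "((\<lambda>t. integral {0..exp (- t)} ?f) \<longlongrightarrow> 0) at_top"
    using filterlim_compose by fastforce
  then show ?thesis
    by (simp add: w_tilde_def)
qed

section \<open>The moving frame\<close>

text \<open>
  $p = \cos\psi$ and $q = \sin\psi$ for the angle $\psi$ with $-B + i C = \rho e^{i\psi}$; the function
  \<open>\<psi>'\<close> is its derivative.
\<close>

definition p :: "real \<Rightarrow> real" where "p x = - B x / \<rho> x"

definition q :: "real \<Rightarrow> real" where "q x = C x / \<rho> x"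

text \<open>The denominator h is the sum of the two terms whose difference is the numerator. This
  makes \<open>\<kappa>\<close> the cosine of an angle with sine 2 rho sqrt(1 + y^2) / h.\<close>

definition \<kappa> :: "real \<Rightarrow> real \<Rightarrow> real" where
  "\<kappa> x y = ((1 + y\<^sup>2) * G x - (H x - G x)) / h x y"

lemma p_q_square: "(p x)\<^sup>2 + (q x)\<^sup>2 = 1"
proof -
  have "(p x)\<^sup>2 + (q x)\<^sup>2 = (\<rho> x)\<^sup>2 / (\<rho> x)\<^sup>2"
    unfolding p_def q_def power_divide power2_minus rho_square by (rule add_divide_distrib[symmetric])
  then show ?thesis
    using rho_pos[of x] by simp
qed

lemma kappa_diff: "x \<noteq> 0 \<Longrightarrow> 1 - \<kappa> x y = 2 * (H x - G x) / h x y"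
  using h_pos[of x y] by (simp add: \<kappa>_def diff_divide_eq_iff) (simp add: h_eq algebra_simps)

text \<open>This is (1 - cos)^2 + sin^2 = 2 (1 - cos), the squared chord of the angle with cosine
  \<open>\<kappa>\<close>.\<close>

lemma kappa_rotation:
  assumes "x \<noteq> 0"
  shows "(1 - \<kappa> x y)\<^sup>2 + (1 + y\<^sup>2) * (2 * \<rho> x / h x y)\<^sup>2 = 4 * (H x - G x) / h x y"
proof -
  have "(1 - \<kappa> x y)\<^sup>2 + (1 + y\<^sup>2) * (2 * \<rho> x / h x y)\<^sup>2 =
      4 * ((H x - G x)\<^sup>2 + (1 + y\<^sup>2) * (\<rho> x)\<^sup>2) / (h x y)\<^sup>2"
    unfolding kappa_diff[OF assms] power_divide power_mult_distrib
    by (simp add: add_divide_distrib distrib_left mult.left_commute)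
  also have "(H x - G x)\<^sup>2 + (1 + y\<^sup>2) * (\<rho> x)\<^sup>2 = (H x - G x) * h x y"
    unfolding rho_square sum_squares_BC h_eq[OF assms] by (simp add: algebra_simps power2_eq_square)
  finally show ?thesis
    using h_pos[OF assms, of y] by (simp add: power2_eq_square)
qed

text \<open>The left side is the component of u_x along w: the turning rate between X_alpha and xi,
  corrected by the rotation psi that leads from these vectors to u and w.\<close>

lemma b\<^sub>1_minus_psi:
  assumes "x \<noteq> 0"
  shows "b\<^sub>1 x y - \<psi>' x = T x * \<kappa> x y"
proof -
  have "sqrt 5 * sqrt 5 = (5::real)" "sqrt 5 * (sqrt 5 * z) = 5 * z" for z :: real
    by simp_all
  then have "- (P x + sqrt 5 * (x\<^sup>2 - y\<^sup>2)) * (\<rho> x)\<^sup>2 - h x y * (sqrt 5 * (H x - G x) + P x * B x) =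
      - B x * P x * ((1 + y\<^sup>2) * G x - (H x - G x))"
    unfolding rho_square sum_squares_BC h_eq[OF assms] unfolding H_eq_P B_def
    by (simp add: field_simps power2_eq_square)
  moreover have "b\<^sub>1 x y - \<psi>' x = (- (P x + sqrt 5 * (x\<^sup>2 - y\<^sup>2)) * (\<rho> x)\<^sup>2 -
      h x y * (sqrt 5 * (H x - G x) + P x * B x)) / (x * h x y * (\<rho> x)\<^sup>2)"
    unfolding structure_coefficients[OF assms] \<psi>'_def
    using assms h_pos[OF assms, of y] rho_pos[of x] by (simp add: diff_divide_distrib)
  moreover have "T x * \<kappa> x y = - B x * P x * ((1 + y\<^sup>2) * G x - (H x - G x)) / (x * h x y * (\<rho> x)\<^sup>2)"
    unfolding T_eq[OF assms] \<kappa>_def by (simp add: mult_ac)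
  ultimately show ?thesis
    by simp
qed

lemma DERIV_p: "x \<noteq> 0 \<Longrightarrow> (p has_real_derivative - (q x * \<psi>' x)) (at x)"
  and DERIV_q: "x \<noteq> 0 \<Longrightarrow> (q has_real_derivative p x * \<psi>' x) (at x)"
  using DERIV_BC_normalized[of x] unfolding p_def[abs_def] q_def[abs_def] by simp_all

section \<open>The rotating pair u, v\<close>

locale frame_field_context =
  fixes \<phi> X\<^sub>\<alpha> X\<^sub>\<beta> \<xi> :: "real \<times> real \<Rightarrow> real ^ 4"
  assumes frame: "frame_field \<phi> X\<^sub>\<alpha> X\<^sub>\<beta> \<xi>"
begin

lemma frame_x:
  assumes "0 < x"
  shows "((\<lambda>s. \<phi> (s, y)) has_vector_derivative - a\<^sub>1 x y *\<^sub>R X\<^sub>\<alpha> (x, y)) (at x)"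
    and "((\<lambda>s. \<xi> (s, y)) has_vector_derivative b\<^sub>1 x y *\<^sub>R X\<^sub>\<alpha> (x, y)) (at x)"
    and "((\<lambda>s. X\<^sub>\<beta> (s, y)) has_vector_derivative c\<^sub>1 x y *\<^sub>R X\<^sub>\<alpha> (x, y)) (at x)"
    and "((\<lambda>s. X\<^sub>\<alpha> (s, y)) has_vector_derivative
          a\<^sub>1 x y *\<^sub>R \<phi> (x, y) - b\<^sub>1 x y *\<^sub>R \<xi> (x, y) - c\<^sub>1 x y *\<^sub>R X\<^sub>\<beta> (x, y)) (at x)"
  using frame assms unfolding frame_field_def D_def by auto

lemma frame_y:
  assumes "0 < x"
  shows "((\<lambda>t. \<phi> (x, t)) has_vector_derivative - a\<^sub>2 x y *\<^sub>R X\<^sub>\<beta> (x, y)) (at y)"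
    and "((\<lambda>t. \<xi> (x, t)) has_vector_derivative b\<^sub>2 x y *\<^sub>R X\<^sub>\<beta> (x, y)) (at y)"
    and "((\<lambda>t. X\<^sub>\<alpha> (x, t)) has_vector_derivative c\<^sub>2 x y *\<^sub>R X\<^sub>\<beta> (x, y)) (at y)"
    and "((\<lambda>t. X\<^sub>\<beta> (x, t)) has_vector_derivative
          a\<^sub>2 x y *\<^sub>R \<phi> (x, y) - b\<^sub>2 x y *\<^sub>R \<xi> (x, y) - c\<^sub>2 x y *\<^sub>R X\<^sub>\<alpha> (x, y)) (at y)"
  using frame assms unfolding frame_field_def D_def by auto

lemma norm_frame_combination:
  assumes "0 < x"
  shows "norm (a *\<^sub>R \<phi> (x, y) + b *\<^sub>R X\<^sub>\<alpha> (x, y) + c *\<^sub>R X\<^sub>\<beta> (x, y) + d *\<^sub>R \<xi> (x, y)) =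
    sqrt (a\<^sup>2 + b\<^sup>2 + c\<^sup>2 + d\<^sup>2)"
proof -
  have "orthonormal [\<phi> (x, y), X\<^sub>\<alpha> (x, y), X\<^sub>\<beta> (x, y), \<xi> (x, y)]"
    using frame assms unfolding frame_field_def D_def by auto
  then have *: "\<forall>i < 4. \<forall>j < 4. [\<phi> (x, y), X\<^sub>\<alpha> (x, y), X\<^sub>\<beta> (x, y), \<xi> (x, y)] ! i \<bullet>
      [\<phi> (x, y), X\<^sub>\<alpha> (x, y), X\<^sub>\<beta> (x, y), \<xi> (x, y)] ! j = (if i = j then 1 else 0)"
    by (simp add: orthonormal_def)
  show ?thesis
    using * unfolding norm_eq_sqrt_inner
    by (simp add: numeral_eq_Suc All_less_Suc inner_add_left inner_add_right power2_eq_square)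
qed

definition u :: "real \<Rightarrow> real \<Rightarrow> real ^ 4" where
  "u x y = p x *\<^sub>R X\<^sub>\<alpha> (x, y) + q x *\<^sub>R \<xi> (x, y)"

definition w :: "real \<Rightarrow> real \<Rightarrow> real ^ 4" where
  "w x y = q x *\<^sub>R X\<^sub>\<alpha> (x, y) - p x *\<^sub>R \<xi> (x, y)"

definition v :: "real \<Rightarrow> real \<Rightarrow> real ^ 4" where
  "v x y = (2 * \<rho> x / h x y) *\<^sub>R (y *\<^sub>R \<phi> (x, y) + X\<^sub>\<beta> (x, y)) + \<kappa> x y *\<^sub>R w x y"

text \<open>Along y both X_alpha and xi move in the direction X_beta, at rates proportional to C and
  B. The coefficients (p, q) are proportional to (-B, C), so the two motions cancel.\<close>

lemma u_independent:
  assumes "0 < x"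
  shows "u x y = u x y'"
proof -
  have "((\<lambda>t. u x t) has_vector_derivative 0) (at t)" for t
  proof -
    have "((\<lambda>t. u x t) has_vector_derivative
        p x *\<^sub>R c\<^sub>2 x t *\<^sub>R X\<^sub>\<beta> (x, t) + q x *\<^sub>R b\<^sub>2 x t *\<^sub>R X\<^sub>\<beta> (x, t)) (at t)"
      unfolding u_def by (rule derivative_eq_intros frame_y[OF assms] refl)+ simp
    moreover have "p x * c\<^sub>2 x t + q x * b\<^sub>2 x t = 0"
      using assms by (simp add: structure_coefficients p_def q_def)
    ultimately show ?thesis
      by (simp flip: scaleR_add_left)
  qed
  then show ?thesis
    using has_vector_derivative_zero_constant[of UNIV "\<lambda>t. u x t"] by (metis UNIV_I convex_UNIV)
qed

text \<open>The factor T comes from p * 2 P / (x h) = T * 2 rho / h. Because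
  \<open>a\<^sub>1\<close> = - y \<open>c\<^sub>1\<close>, the components along phi and X_beta
  combine to a multiple of y phi + X_beta.\<close>

lemma u_has_derivative:
  assumes "0 < x"
  shows "((\<lambda>s. u s y) has_vector_derivative T x *\<^sub>R v x y) (at x)"
proof (rule has_vector_derivative_eq_rhs)
  have nz: "x \<noteq> 0" using assms by simp
  show "((\<lambda>s. u s y) has_vector_derivative
      (p x *\<^sub>R (a\<^sub>1 x y *\<^sub>R \<phi> (x, y) - b\<^sub>1 x y *\<^sub>R \<xi> (x, y) - c\<^sub>1 x y *\<^sub>R X\<^sub>\<beta> (x, y))
        + (- (q x * \<psi>' x)) *\<^sub>R X\<^sub>\<alpha> (x, y)) +
      (q x *\<^sub>R b\<^sub>1 x y *\<^sub>R X\<^sub>\<alpha> (x, y) + (p x * \<psi>' x) *\<^sub>R \<xi> (x, y))) (at x)"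
    unfolding u_def
    by (intro has_vector_derivative_add has_vector_derivative_scaleR frame_x DERIV_p DERIV_q assms nz)
  have "(p x *\<^sub>R (a\<^sub>1 x y *\<^sub>R \<phi> (x, y) - b\<^sub>1 x y *\<^sub>R \<xi> (x, y) - c\<^sub>1 x y *\<^sub>R X\<^sub>\<beta> (x, y))
        + (- (q x * \<psi>' x)) *\<^sub>R X\<^sub>\<alpha> (x, y)) +
      (q x *\<^sub>R b\<^sub>1 x y *\<^sub>R X\<^sub>\<alpha> (x, y) + (p x * \<psi>' x) *\<^sub>R \<xi> (x, y))
      = (p x * a\<^sub>1 x y) *\<^sub>R \<phi> (x, y) + (q x * (b\<^sub>1 x y - \<psi>' x)) *\<^sub>R X\<^sub>\<alpha> (x, y)
      + (- (p x * c\<^sub>1 x y)) *\<^sub>R X\<^sub>\<beta> (x, y) + (- (p x * (b\<^sub>1 x y - \<psi>' x))) *\<^sub>R \<xi> (x, y)"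
    by (simp add: algebra_simps)
  also have "p x * a\<^sub>1 x y = T x * (2 * \<rho> x / h x y) * y"
    using nz rho_pos[of x] h_pos[OF nz, of y]
    by (simp add: structure_coefficients T_eq p_def power2_eq_square mult_ac)
  also have "- (p x * c\<^sub>1 x y) = T x * (2 * \<rho> x / h x y)"
    using nz rho_pos[of x] h_pos[OF nz, of y]
    by (simp add: structure_coefficients T_eq p_def power2_eq_square mult_ac)
  also have "b\<^sub>1 x y - \<psi>' x = T x * \<kappa> x y"
    using b\<^sub>1_minus_psi[OF nz] .
  also have "(T x * (2 * \<rho> x / h x y) * y) *\<^sub>R \<phi> (x, y) + (q x * (T x * \<kappa> x y)) *\<^sub>R X\<^sub>\<alpha> (x, y)
      + (T x * (2 * \<rho> x / h x y)) *\<^sub>R X\<^sub>\<beta> (x, y) + (- (p x * (T x * \<kappa> x y))) *\<^sub>R \<xi> (x, y) =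
      T x *\<^sub>R v x y"
    unfolding v_def w_def by (simp only: scaleR_add_right scaleR_diff_right scaleR_scaleR
       scaleR_minus_left mult_ac) simp
  finally show "(p x *\<^sub>R (a\<^sub>1 x y *\<^sub>R \<phi> (x, y) - b\<^sub>1 x y *\<^sub>R \<xi> (x, y) - c\<^sub>1 x y *\<^sub>R X\<^sub>\<beta> (x, y))
        + (- (q x * \<psi>' x)) *\<^sub>R X\<^sub>\<alpha> (x, y)) +
      (q x *\<^sub>R b\<^sub>1 x y *\<^sub>R X\<^sub>\<alpha> (x, y) + (p x * \<psi>' x) *\<^sub>R \<xi> (x, y)) = T x *\<^sub>R v x y" .
qed

lemma v_independent:
  assumes "0 < x"
  shows "v x y = v x y'"
proof -
  have "((\<lambda>s. u s y) has_vector_derivative T x *\<^sub>R v x y') (at x)"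
    using u_has_derivative[OF assms, of y'] open_greaterThan
    by (rule has_vector_derivative_transform_within_open) (use assms u_independent in auto)
  with u_has_derivative[OF assms, of y] have "T x *\<^sub>R v x y = T x *\<^sub>R v x y'"
    by (rule vector_derivative_unique_at)
  then show ?thesis
    using T_pos[OF assms] by simp
qed

lemma v_has_derivative:
  assumes "0 < x"
  shows "((\<lambda>s. v s y) has_vector_derivative - T x *\<^sub>R u x y) (at x)"
proof -
  have nz: "x \<noteq> 0" using assms by simp
  \<comment> \<open>This is v at y = 0, where h reduces to H and the phi component drops
    out.\<close>
  define v\<^sub>0 where "v\<^sub>0 = (\<lambda>s. (2 * \<rho> s / H s) *\<^sub>R X\<^sub>\<beta> (s, 0) +
      ((2 * G s - H s) / H s) *\<^sub>R (q s *\<^sub>R X\<^sub>\<alpha> (s, 0) - p s *\<^sub>R \<xi> (s, 0)))"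
  have v\<^sub>0: "v\<^sub>0 s = v s y" if "0 < s" for s
    using that v_independent[OF that, of 0 y] by (simp add: v\<^sub>0_def v_def w_def \<kappa>_def h_eq)
  define k where "k = (2 * G x - H x) / H x"
  define l where "l = 2 * \<rho> x / H x"
  define l' where "l' = 2 * P x * C x * (H x - 2 * G x) / (x * \<rho> x * (H x)\<^sup>2)"
  define k' where "k' = 4 * P x * C x / (x * (H x)\<^sup>2)"
  have bk: "b\<^sub>1 x 0 - \<psi>' x = T x * k"
    using b\<^sub>1_minus_psi[OF nz, of 0] nz by (simp add: k_def \<kappa>_def h_eq)
  have "(2 * G x - H x)\<^sup>2 + 4 * (\<rho> x)\<^sup>2 = (H x)\<^sup>2"
    unfolding rho_square sum_squares_BC by (simp add: algebra_simps power2_eq_square)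
  then have kl: "k\<^sup>2 + l\<^sup>2 = 1"
    using H_pos[of x] by (simp add: k_def l_def power_divide power_mult_distrib flip: add_divide_distrib)
  have a1: "a\<^sub>1 x 0 = 0"
    using nz by (simp add: structure_coefficients)
  have "(v\<^sub>0 has_vector_derivative
      (l *\<^sub>R c\<^sub>1 x 0 *\<^sub>R X\<^sub>\<alpha> (x, 0) + l' *\<^sub>R X\<^sub>\<beta> (x, 0)) +
      (k *\<^sub>R ((q x *\<^sub>R (a\<^sub>1 x 0 *\<^sub>R \<phi> (x, 0) - b\<^sub>1 x 0 *\<^sub>R \<xi> (x, 0) - c\<^sub>1 x 0 *\<^sub>R X\<^sub>\<beta> (x, 0))
        + (p x * \<psi>' x) *\<^sub>R X\<^sub>\<alpha> (x, 0)) -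
      (p x *\<^sub>R b\<^sub>1 x 0 *\<^sub>R X\<^sub>\<alpha> (x, 0) + (- (q x * \<psi>' x)) *\<^sub>R \<xi> (x, 0)))
       + k' *\<^sub>R (q x *\<^sub>R X\<^sub>\<alpha> (x, 0) - p x *\<^sub>R \<xi> (x, 0)))) (at x)"
    unfolding v\<^sub>0_def k_def l_def k'_def l'_def
    by (intro has_vector_derivative_add has_vector_derivative_diff has_vector_derivative_scaleR frame_x
        DERIV_p DERIV_q DERIV_rho_H DERIV_G_H assms nz)
  also have "(l *\<^sub>R c\<^sub>1 x 0 *\<^sub>R X\<^sub>\<alpha> (x, 0) + l' *\<^sub>R X\<^sub>\<beta> (x, 0)) +
      (k *\<^sub>R ((q x *\<^sub>R (a\<^sub>1 x 0 *\<^sub>R \<phi> (x, 0) - b\<^sub>1 x 0 *\<^sub>R \<xi> (x, 0) - c\<^sub>1 x 0 *\<^sub>R X\<^sub>\<beta> (x, 0))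
        + (p x * \<psi>' x) *\<^sub>R X\<^sub>\<alpha> (x, 0)) -
      (p x *\<^sub>R b\<^sub>1 x 0 *\<^sub>R X\<^sub>\<alpha> (x, 0) + (- (q x * \<psi>' x)) *\<^sub>R \<xi> (x, 0)))
       + k' *\<^sub>R (q x *\<^sub>R X\<^sub>\<alpha> (x, 0) - p x *\<^sub>R \<xi> (x, 0)))
    = (l * c\<^sub>1 x 0 - k * p x * (b\<^sub>1 x 0 - \<psi>' x) + k' * q x) *\<^sub>R X\<^sub>\<alpha> (x, 0) +
      (l' - k * q x * c\<^sub>1 x 0) *\<^sub>R X\<^sub>\<beta> (x, 0) +
      (- k * q x * (b\<^sub>1 x 0 - \<psi>' x) - k' * p x) *\<^sub>R \<xi> (x, 0)"
    by (simp add: a1 algebra_simps)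
  \<comment> \<open>The change of the X_beta coefficient compensates the turning of X_alpha towards
    X_beta.\<close>
  also have "l' - k * q x * c\<^sub>1 x 0 = 0"
    using nz H_pos[of x] by (simp add: l'_def k_def q_def structure_coefficients h_eq power2_eq_square)
      (simp add: divide_simps algebra_simps)
  \<comment> \<open>The middle term contributes k^2 through \<open>bk\<close>; the outer ones
    contribute l^2 through C^2 - rho^2 = - B^2. With k^2 + l^2 = 1 exactly - T p is left. The xi
    component is split in the same way.\<close>
  also have "l * c\<^sub>1 x 0 - k * p x * (b\<^sub>1 x 0 - \<psi>' x) + k' * q x = - T x * p x"
  proof -
    have "l * c\<^sub>1 x 0 + k' * q x = 4 * P x * ((C x)\<^sup>2 - (\<rho> x)\<^sup>2) / (x * (H x)\<^sup>2 * \<rho> x)"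
      using nz H_pos[of x] rho_pos[of x]
      by (simp add: l_def k'_def q_def structure_coefficients h_eq power2_eq_square)
        (simp add: divide_simps algebra_simps)
    also have "(C x)\<^sup>2 - (\<rho> x)\<^sup>2 = - (B x)\<^sup>2"
      by (simp add: rho_square)
    also have "4 * P x * - (B x)\<^sup>2 / (x * (H x)\<^sup>2 * \<rho> x) = - (T x * p x * l\<^sup>2)"
      using nz H_pos[of x] rho_pos[of x] by (simp add: T_eq p_def l_def power_divide power_mult_distrib)
        (simp add: power2_eq_square mult_ac)
    finally have "l * c\<^sub>1 x 0 - k * p x * (b\<^sub>1 x 0 - \<psi>' x) + k' * q x = - T x * p x * (k\<^sup>2 + l\<^sup>2)"
      unfolding bk by (simp add: algebra_simps power2_eq_square)
    then show ?thesis
      by (simp add: kl)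
  qed
  also have "- k * q x * (b\<^sub>1 x 0 - \<psi>' x) - k' * p x = - T x * q x"
  proof -
    have "k' * p x = T x * q x * l\<^sup>2"
      using nz H_pos[of x] rho_pos[of x] by (simp add: k'_def T_eq p_def q_def l_def power_divide power_mult_distrib)
        (simp add: power2_eq_square mult_ac)
    then have "- k * q x * (b\<^sub>1 x 0 - \<psi>' x) - k' * p x = - T x * q x * (k\<^sup>2 + l\<^sup>2)"
      unfolding bk by (simp add: algebra_simps power2_eq_square)
    then show ?thesis
      by (simp add: kl)
  qed
  also have "(- T x * p x) *\<^sub>R X\<^sub>\<alpha> (x, 0) + 0 *\<^sub>R X\<^sub>\<beta> (x, 0) + (- T x * q x) *\<^sub>R \<xi> (x, 0) = - T x *\<^sub>R u x y"
    unfolding u_independent[OF assms, of y 0] by (simp add: u_def scaleR_add_right)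
  finally show ?thesis
    using open_greaterThan by (rule has_vector_derivative_transform_within_open) (use v\<^sub>0 assms in auto)
qed

section \<open>The surface and its distance from the limit point\<close>

lemma u_tilde_eq:
  assumes "0 < x"
  shows "u_tilde X\<^sub>\<alpha> \<xi> x = u x y"
proof -
  have *: "(1 / sqrt ((B\<^sub>2 x)\<^sup>2 + (C\<^sub>2 x)\<^sup>2)) *\<^sub>R (- B\<^sub>2 x *\<^sub>R X\<^sub>\<alpha> (x, t) + C\<^sub>2 x *\<^sub>R \<xi> (x, t)) = u x t" for t
    using assms by (simp add: B\<^sub>2_eq C\<^sub>2_eq u_def p_def q_def scaleR_add_right scaleR_diff_right divide_inverse
        mult.commute flip: \<rho>_def)
  show ?thesis
    unfolding u_tilde_def * using u_independent[OF assms] by (intro the_equality) metis+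
qed

text \<open>Along y both f and w move in the direction X_beta, w with rho times the speed of f,
  since p^2 + q^2 = 1. Hence f - w / rho is constant in y.\<close>

lemma A_tilde_eq:
  assumes f: "curvature_surface X\<^sub>\<alpha> X\<^sub>\<beta> f" and "0 < x"
  shows "A_tilde X\<^sub>\<alpha> \<xi> f x = f (x, y) - (1 / \<rho> x) *\<^sub>R w x y"
proof -
  have nz: "x \<noteq> 0" using \<open>0 < x\<close> by simp
  have *: "f (x, t) - (1 / ((B\<^sub>2 x)\<^sup>2 + (C\<^sub>2 x)\<^sup>2)) *\<^sub>R (B\<^sub>2 x *\<^sub>R \<xi> (x, t) + C\<^sub>2 x *\<^sub>R X\<^sub>\<alpha> (x, t)) =
      f (x, t) - (1 / \<rho> x) *\<^sub>R w x t" for t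
    unfolding B\<^sub>2_eq[OF nz] C\<^sub>2_eq[OF nz] rho_square[symmetric]
    by (simp add: w_def p_def q_def scaleR_add_right power2_eq_square)
  have "((\<lambda>t. f (x, t) - (1 / \<rho> x) *\<^sub>R w x t) has_vector_derivative 0) (at t)" for t
  proof -
    have "(f has_derivative (\<lambda>(dx, dy). ((x\<^sup>2 - t\<^sup>2) / (x * h x t) * dx) *\<^sub>R X\<^sub>\<alpha> (x, t)
        + (2 * t / h x t * dy) *\<^sub>R X\<^sub>\<beta> (x, t))) (at (x, t))"
      using f \<open>0 < x\<close> unfolding curvature_surface_def D_def by auto
    moreover have "((\<lambda>t. (x, t)) has_derivative (\<lambda>dt. (0, dt))) (at t)"
      by (intro derivative_intros)
    ultimately have "((\<lambda>t. f (x, t)) has_vector_derivative (2 * t / h x t) *\<^sub>R X\<^sub>\<beta> (x, t)) (at t)"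
      unfolding has_vector_derivative_def by (auto dest: has_derivative_compose simp: mult.commute)
    then have "((\<lambda>t. f (x, t) - (1 / \<rho> x) *\<^sub>R w x t) has_vector_derivative
        (2 * t / h x t) *\<^sub>R X\<^sub>\<beta> (x, t) - (1 / \<rho> x) *\<^sub>R
          (q x *\<^sub>R c\<^sub>2 x t *\<^sub>R X\<^sub>\<beta> (x, t) - p x *\<^sub>R b\<^sub>2 x t *\<^sub>R X\<^sub>\<beta> (x, t))) (at t)"
      unfolding w_def by (auto intro!: derivative_eq_intros frame_y \<open>0 < x\<close>)
    also have "(2 * t / h x t) *\<^sub>R X\<^sub>\<beta> (x, t) - (1 / \<rho> x) *\<^sub>R
          (q x *\<^sub>R c\<^sub>2 x t *\<^sub>R X\<^sub>\<beta> (x, t) - p x *\<^sub>R b\<^sub>2 x t *\<^sub>R X\<^sub>\<beta> (x, t)) =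
        (2 * t / h x t - (q x * c\<^sub>2 x t - p x * b\<^sub>2 x t) / \<rho> x) *\<^sub>R X\<^sub>\<beta> (x, t)"
      by (simp add: scaleR_diff_left scaleR_diff_right diff_divide_distrib)
    also have "q x * c\<^sub>2 x t - p x * b\<^sub>2 x t = 2 * t / h x t * ((p x)\<^sup>2 + (q x)\<^sup>2) * \<rho> x"
      using rho_pos[of x] nz unfolding structure_coefficients[OF nz]
      by (simp add: p_def q_def power2_eq_square algebra_simps)
    finally show ?thesis
      using rho_pos[of x] by (simp add: p_q_square)
  qed
  then have const: "f (x, t) - (1 / \<rho> x) *\<^sub>R w x t = f (x, y) - (1 / \<rho> x) *\<^sub>R w x y" for t
    using has_vector_derivative_zero_constant[of UNIV "\<lambda>t. f (x, t) - (1 / \<rho> x) *\<^sub>R w x t"]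
    by (metis UNIV_I convex_UNIV)
  show ?thesis
    unfolding A_tilde_def * using const by (intro the_equality) metis+
qed

lemma norm_w_minus_v:
  assumes "0 < x"
  shows "norm (w x y - v x y) = 2 * sqrt ((H x - G x) / h x y)"
proof -
  let ?l = "2 * \<rho> x / h x y"
  have nz: "x \<noteq> 0" using assms by simp
  have "w x y - v x y = (- ?l * y) *\<^sub>R \<phi> (x, y) + ((1 - \<kappa> x y) * q x) *\<^sub>R X\<^sub>\<alpha> (x, y) +
      (- ?l) *\<^sub>R X\<^sub>\<beta> (x, y) + (- ((1 - \<kappa> x y) * p x)) *\<^sub>R \<xi> (x, y)"
    unfolding v_def w_def by (simp add: algebra_simps)
  then have "norm (w x y - v x y) = sqrt ((- ?l * y)\<^sup>2 + ((1 - \<kappa> x y) * q x)\<^sup>2 + (- ?l)\<^sup>2 +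
      (- ((1 - \<kappa> x y) * p x))\<^sup>2)"
    by (simp only: norm_frame_combination[OF assms])
  also have "(- ?l * y)\<^sup>2 + ((1 - \<kappa> x y) * q x)\<^sup>2 + (- ?l)\<^sup>2 + (- ((1 - \<kappa> x y) * p x))\<^sup>2 =
      (1 - \<kappa> x y)\<^sup>2 * ((p x)\<^sup>2 + (q x)\<^sup>2) + (1 + y\<^sup>2) * ?l\<^sup>2"
    by (simp only: power_mult_distrib power2_minus mult_minus_left distrib_left distrib_right)
      (simp add: mult_ac)
  also have "\<dots> = 4 * ((H x - G x) / h x y)"
    using kappa_rotation[OF nz, of y] by (simp add: p_q_square)
  finally show ?thesis
    by (simp only: real_sqrt_mult real_sqrt_four)
qed

text \<open>Dividing the chord by rho = sqrt(G (H - G)) cancels H - G, and h \<ge> y^2 G then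
  separates the variables. The argument y' is free because v does not depend on it.\<close>

lemma norm_surface_minus_limit:
  assumes f: "curvature_surface X\<^sub>\<alpha> X\<^sub>\<beta> f" and "0 < x" "0 < y"
  shows "norm (f (x, y) - ((1 / \<rho> x) *\<^sub>R v x y' + A_tilde X\<^sub>\<alpha> \<xi> f x)) \<le> 2 / G x * (1 / y)"
proof -
  have nz: "x \<noteq> 0" using \<open>0 < x\<close> by simp
  have "f (x, y) - ((1 / \<rho> x) *\<^sub>R v x y' + A_tilde X\<^sub>\<alpha> \<xi> f x) = (1 / \<rho> x) *\<^sub>R (w x y - v x y)"
    unfolding A_tilde_eq[OF f \<open>0 < x\<close>, of y] v_independent[OF \<open>0 < x\<close>, of y' y]
    by (simp add: scaleR_diff_right)
  then have "norm (f (x, y) - ((1 / \<rho> x) *\<^sub>R v x y' + A_tilde X\<^sub>\<alpha> \<xi> f x)) =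
      2 * sqrt ((H x - G x) / h x y) / \<rho> x"
    using norm_w_minus_v[OF \<open>0 < x\<close>] rho_pos[of x] by simp
  also have "\<dots> = 2 * (sqrt (1 / (G x * h x y)))"
    using G_pos[of x] H_minus_G_pos[of x]
    by (simp add: \<rho>_def sum_squares_BC real_sqrt_divide real_sqrt_mult)
  also have "\<dots> \<le> 2 * (sqrt ((1 / (G x * y))\<^sup>2))"
    using h_ge[OF nz, of y] G_pos[of x] \<open>0 < y\<close> h_pos[OF nz, of y]
    by (intro mult_left_mono real_sqrt_le_mono) (auto simp: power2_eq_square frac_le mult_ac intro!: divide_left_mono)
  also have "\<dots> = 2 / G x * (1 / y)"
    using G_pos[of x] \<open>0 < y\<close> by simp
  finally show ?thesis .
qed

end

section \<open>Asymptotics\<close>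

lemma cos_sin_shift_tendsto:
  fixes d :: "real \<Rightarrow> real"
  assumes "(d \<longlongrightarrow> 0) F"
  shows "((\<lambda>t. cos (a t + d t) - cos (a t)) \<longlongrightarrow> 0) F" (is ?cos)
    and "((\<lambda>t. sin (a t + d t) - sin (a t)) \<longlongrightarrow> 0) F" (is ?sin)
proof -
  have *: "((\<lambda>t. \<bar>cos (d t) - 1\<bar> + \<bar>sin (d t)\<bar>) \<longlongrightarrow> 0) F"
    by (rule tendsto_eq_intros assms refl)+ simp
  have bound: "\<bar>r * (cos e - 1) + s * sin e\<bar> \<le> \<bar>cos e - 1\<bar> + \<bar>sin e\<bar>" if "\<bar>r\<bar> \<le> 1" "\<bar>s\<bar> \<le> 1" for r s e :: real
    using abs_triangle_ineq[of "r * (cos e - 1)" "s * sin e"] that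
      mult_right_mono[OF that(1), of "\<bar>cos e - 1\<bar>"] mult_right_mono[OF that(2), of "\<bar>sin e\<bar>"]
    by (simp add: abs_mult)
  have "cos (a t + d t) - cos (a t) = cos (a t) * (cos (d t) - 1) + (- sin (a t)) * sin (d t)" for t
    by (simp add: cos_add algebra_simps)
  with bound[of "cos (a _)" "- sin (a _)"] show ?cos
    by (intro Lim_null_comparison[OF _ *] always_eventually) simp
  have "sin (a t + d t) - sin (a t) = sin (a t) * (cos (d t) - 1) + cos (a t) * sin (d t)" for t
    by (simp add: sin_add algebra_simps)
  with bound[of "sin (a _)" "cos (a _)"] show ?sin
    by (intro Lim_null_comparison[OF _ *] always_eventually) simp
qed

text \<open>Sampled at the times where k t is a multiple of 2 pi, the combination is constantly d; a
  quarter turn later it is constantly - e.\<close>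

lemma rotating_combination_tendsto_0D:
  fixes d e :: "'a :: real_normed_vector"
  assumes "((\<lambda>t. cos (k * t) *\<^sub>R d - sin (k * t) *\<^sub>R e) \<longlongrightarrow> 0) at_top" and "0 < k"
  shows "d = 0" and "e = 0"
proof -
  have lim: "((\<lambda>n. cos (real n * (2 * pi) + r) *\<^sub>R d - sin (real n * (2 * pi) + r) *\<^sub>R e) \<longlongrightarrow> 0) sequentially" for r
  proof -
    have "filterlim (\<lambda>n. r / k + 2 * pi / k * real n) at_top sequentially"
      using \<open>0 < k\<close> by (intro filterlim_tendsto_add_at_top[OF tendsto_const]
        filterlim_tendsto_pos_mult_at_top[OF tendsto_const] filterlim_real_sequentially) simp
    from filterlim_compose[OF assms(1) this] show ?thesis
      using \<open>0 < k\<close> by (simp add: distrib_left mult_ac add.commute)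
  qed
  have "cos (real n * (2 * pi)) = 1" "sin (real n * (2 * pi)) = 0" for n
    using cos_2npi[of n] sin_2npi[of n] by (simp_all add: mult_ac)
  then show "d = 0" "e = 0"
    using lim[of 0] lim[of "pi / 2"] by (simp_all add: cos_add sin_add tendsto_const_iff)
qed

text \<open>A bound with separated variables suffices: the continuous factor K is bounded on compact
  sets.\<close>

lemma converges_uniformly_wideI:
  assumes K: "continuous_on {0<..} K"
    and \<beta>: "(\<beta> \<longlongrightarrow> 0) at_top"
    and bound: "\<And>x y. 0 < x \<Longrightarrow> 0 < y \<Longrightarrow> norm (M x y - N x y) \<le> K x * \<beta> y"
  shows "converges_uniformly_wide M N"
  unfolding converges_uniformly_wide_def
proof (intro allI impI)
  fix S :: "real set" and \<epsilon> :: real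
  assume S: "compact S \<and> S \<subseteq> {0<..}" and "0 < \<epsilon>"
  then have "bounded (K ` S)"
    using K by (intro compact_imp_bounded compact_continuous_image) (auto intro: continuous_on_subset)
  then obtain k where k: "0 < k" "\<And>x. x \<in> S \<Longrightarrow> \<bar>K x\<bar> \<le> k"
    by (auto simp: bounded_pos)
  have "\<forall>\<^sub>F y in at_top. \<bar>\<beta> y\<bar> < \<epsilon> / k"
    using \<beta> k(1) \<open>0 < \<epsilon>\<close> by (auto simp: tendsto_iff)
  then obtain R where R: "\<And>y. y \<ge> R \<Longrightarrow> \<bar>\<beta> y\<bar> < \<epsilon> / k"
    by (auto simp: eventually_at_top_linorder)
  \<comment> \<open>The maximum with 0 secures 0 < y, which the bound assumes.\<close>
  have "norm (M x y - N x y) < \<epsilon>" if "x \<in> S" "max 0 R < y" for x y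
  proof -
    have "norm (M x y - N x y) \<le> K x * \<beta> y"
      using S that by (intro bound) auto
    also have "\<dots> \<le> \<bar>K x\<bar> * \<bar>\<beta> y\<bar>"
      by (metis abs_ge_self abs_mult)
    also have "\<dots> \<le> k * \<bar>\<beta> y\<bar>"
      using k(2)[OF that(1)] by (intro mult_right_mono) auto
    also have "\<dots> < k * (\<epsilon> / k)"
      using R[of y] that k(1) by (intro mult_strict_left_mono) auto
    finally show ?thesis
      using k(1) by simp
  qed
  then show "\<exists>R. \<forall>x\<in>S. \<forall>y>R. norm (M x y - N x y) < \<epsilon>"
    by blast
qed

lemma converges_uniformly_if_wide:
  assumes "converges_uniformly_wide M N" "0 < x"
  shows "converges_uniformly (M x) (N x)"
  using assms(1)[unfolded converges_uniformly_wide_def, rule_format, of "{x}"] assms(2)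
  by (simp add: converges_uniformly_def)

lemma continuous_on_G: "continuous_on S G"
  and continuous_on_H: "continuous_on S H"
  by (intro continuous_at_imp_continuous_on ballI DERIV_isCont[OF DERIV_G] DERIV_isCont[OF DERIV_H])+

lemma converges_uniformly_wide_cong:
  assumes "\<And>x y. 0 < x \<Longrightarrow> N x y = N' x y"
  shows "converges_uniformly_wide M N = converges_uniformly_wide M N'"
  unfolding converges_uniformly_wide_def using assms by (smt (verit, best) greaterThan_iff subset_iff)

lemma inverse_tendsto_0: "((\<lambda>y. 1 / y) \<longlongrightarrow> (0::real)) at_top"
  using tendsto_inverse_0_at_top[OF filterlim_ident] by (simp add: inverse_eq_divide)

text \<open>As arctan y tends to pi / 2, both circles are turned back by a quarter in the limit: (-
  sin, cos) becomes (cos, sin), and (- cos, - sin) becomes (- sin, cos).\<close>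

lemma shifted_circle_tendsto:
  shows "((\<lambda>y. (- sin (y - arctan y) *\<^sub>R bt + cos (y - arctan y) *\<^sub>R ct) - b_tilde bt ct y) \<longlongrightarrow> 0) at_top"
    and "((\<lambda>y. v1_vec bt ct y - c_tilde bt ct y) \<longlongrightarrow> 0) at_top"
proof -
  have "((\<lambda>y. pi / 2 - arctan y) \<longlongrightarrow> pi / 2 - pi / 2) at_top"
    by (intro tendsto_intros tendsto_arctan_at_top)
  then have d: "((\<lambda>y. pi / 2 - arctan y) \<longlongrightarrow> 0) at_top"
    by simp
  have shift: "y + (pi / 2 - arctan y) = (y - arctan y) + pi / 2" for y
    by simp
  have s: "((\<lambda>y. cos (y - arctan y) - sin y) \<longlongrightarrow> 0) at_top"
    using cos_sin_shift_tendsto(2)[OF d, of "\<lambda>y. y"] unfolding shift sin_add by simp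
  have c: "((\<lambda>y. - sin (y - arctan y) - cos y) \<longlongrightarrow> 0) at_top"
    using cos_sin_shift_tendsto(1)[OF d, of "\<lambda>y. y"] unfolding shift cos_add by simp
  have "((\<lambda>y. (- sin (y - arctan y) - cos y) *\<^sub>R bt + (cos (y - arctan y) - sin y) *\<^sub>R ct) \<longlongrightarrow> 0 *\<^sub>R bt + 0 *\<^sub>R ct) at_top"
    by (intro tendsto_intros s c)
  then show "((\<lambda>y. (- sin (y - arctan y) *\<^sub>R bt + cos (y - arctan y) *\<^sub>R ct) - b_tilde bt ct y) \<longlongrightarrow> 0) at_top"
    by (simp add: b_tilde_def algebra_simps)
  have "((\<lambda>y. - (cos (y - arctan y) - sin y) *\<^sub>R bt + (- sin (y - arctan y) - cos y) *\<^sub>R ct) \<longlongrightarrow> - 0 *\<^sub>R bt + 0 *\<^sub>R ct) at_top"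
    by (intro tendsto_intros s c)
  then show "((\<lambda>y. v1_vec bt ct y - c_tilde bt ct y) \<longlongrightarrow> 0) at_top"
    by (simp add: v1_vec_def c_tilde_def algebra_simps)
qed

lemma p_q_tendsto: "(p \<longlongrightarrow> 1) (at 0)" "(q \<longlongrightarrow> 0) (at 0)"
proof -
  have "\<rho> 0 = - B 0"
    using B_neg[of 0] by (simp add: \<rho>_def C_0)
  then have "p 0 = 1" "q 0 = 0"
    using B_neg[of 0] by (simp_all add: p_def q_def C_0)
  moreover have "isCont p 0" "isCont q 0"
    unfolding p_def[abs_def] q_def[abs_def] using rho_pos[of 0]
    by (auto intro!: continuous_intros DERIV_isCont[OF DERIV_B] DERIV_isCont[OF DERIV_C] DERIV_isCont[OF DERIV_rho])
  ultimately show "(p \<longlongrightarrow> 1) (at 0)" "(q \<longlongrightarrow> 0) (at 0)"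
    by (auto simp: isCont_def)
qed

section \<open>The plane and the initial phase of the rotation\<close>

context frame_field_context
begin

lemma u_v_eq:
  assumes bc: "is_bc_inf X\<^sub>\<alpha> b c" and "0 < x"
  shows "u x y = cos (w_tilde x) *\<^sub>R b + sin (w_tilde x) *\<^sub>R c"
    and "v x y = - sin (w_tilde x) *\<^sub>R b + cos (w_tilde x) *\<^sub>R c"
proof -
  \<comment> \<open>Turning (u, v) back by the angle \<open>w_tilde\<close> gives a constant pair,
    since T is the derivative of that angle.\<close>
  define e\<^sub>1 where "e\<^sub>1 = (\<lambda>s. cos (w_tilde s) *\<^sub>R u s 0 - sin (w_tilde s) *\<^sub>R v s 0)"
  define e\<^sub>2 where "e\<^sub>2 = (\<lambda>s. sin (w_tilde s) *\<^sub>R u s 0 + cos (w_tilde s) *\<^sub>R v s 0)"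
  have d1: "(e\<^sub>1 has_vector_derivative 0) (at s within {0<..})"
    and d2: "(e\<^sub>2 has_vector_derivative 0) (at s within {0<..})" if "s \<in> {0<..}" for s
  proof -
    have s: "0 < s" using that by simp
    show "(e\<^sub>1 has_vector_derivative 0) (at s within {0<..})"
      unfolding e\<^sub>1_def
      by (rule has_vector_derivative_at_within)
        (auto intro!: derivative_eq_intros DERIV_w_tilde u_has_derivative v_has_derivative s simp: algebra_simps)
    show "(e\<^sub>2 has_vector_derivative 0) (at s within {0<..})"
      unfolding e\<^sub>2_def
      by (rule has_vector_derivative_at_within)
        (auto intro!: derivative_eq_intros DERIV_w_tilde u_has_derivative v_has_derivative s simp: algebra_simps)
  qed
  obtain E\<^sub>1 where E\<^sub>1: "\<And>s. s \<in> {0<..} \<Longrightarrow> e\<^sub>1 s = E\<^sub>1"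
    using has_vector_derivative_zero_constant[OF convex_real_interval(3) d1] by blast
  obtain E\<^sub>2 where E\<^sub>2: "\<And>s. s \<in> {0<..} \<Longrightarrow> e\<^sub>2 s = E\<^sub>2"
    using has_vector_derivative_zero_constant[OF convex_real_interval(3) d2] by blast
  have u: "u s 0 = cos (w_tilde s) *\<^sub>R E\<^sub>1 + sin (w_tilde s) *\<^sub>R E\<^sub>2"
    and v: "v s 0 = - sin (w_tilde s) *\<^sub>R E\<^sub>1 + cos (w_tilde s) *\<^sub>R E\<^sub>2" if "0 < s" for s
  proof -
    have E: "E\<^sub>1 = e\<^sub>1 s" "E\<^sub>2 = e\<^sub>2 s"
      using E\<^sub>1[of s] E\<^sub>2[of s] that by simp_all
    have sq: "(sin (w_tilde s) * sin (w_tilde s)) *\<^sub>R z + (cos (w_tilde s) * cos (w_tilde s)) *\<^sub>R z = z"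
      for z :: "real ^ 4"
      unfolding scaleR_add_left[symmetric] power2_eq_square[symmetric] sin_cos_squared_add by simp
    show "u s 0 = cos (w_tilde s) *\<^sub>R E\<^sub>1 + sin (w_tilde s) *\<^sub>R E\<^sub>2"
      unfolding E e\<^sub>1_def e\<^sub>2_def using sq[of "u s 0"] by (simp add: algebra_simps)
    show "v s 0 = - sin (w_tilde s) *\<^sub>R E\<^sub>1 + cos (w_tilde s) *\<^sub>R E\<^sub>2"
      unfolding E e\<^sub>1_def e\<^sub>2_def using sq[of "v s 0"] by (simp add: algebra_simps)
  qed
  define \<tau> where "\<tau> = (\<lambda>t. sqrt 5 / 2 * t :: real)"
  let ?W = "\<lambda>t. w_tilde (exp (- t))"
  have exp0: "filterlim (\<lambda>t. exp (- t)) (at 0) (at_top :: real filter)"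
    unfolding filterlim_at
    by (auto intro!: filterlim_compose[OF exp_at_bot] filterlim_uminus_at_bot_at_top)
  \<comment> \<open>As C vanishes at 0, (p, q) tends to (1, 0) there, so u merges with X_alpha,
    whose asymptotics define b and c.\<close>
  have X_u: "((\<lambda>t. X\<^sub>\<alpha> (exp (- t), 0) - u (exp (- t)) 0) \<longlongrightarrow> 0) at_top"
  proof (rule Lim_null_comparison)
    show "\<forall>\<^sub>F t in at_top. norm (X\<^sub>\<alpha> (exp (- t), 0) - u (exp (- t)) 0) \<le>
        \<bar>1 - p (exp (- t))\<bar> + \<bar>q (exp (- t))\<bar>"
    proof (intro always_eventually allI)
      fix t :: real
      let ?x = "exp (- t)"
      have "X\<^sub>\<alpha> (?x, 0) - u ?x 0 = (1 - p ?x) *\<^sub>R X\<^sub>\<alpha> (?x, 0) + (- q ?x) *\<^sub>R \<xi> (?x, 0)"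
        by (simp add: u_def algebra_simps)
      then show "norm (X\<^sub>\<alpha> (?x, 0) - u ?x 0) \<le> \<bar>1 - p ?x\<bar> + \<bar>q ?x\<bar>"
        using norm_frame_combination[of ?x 0 0 "1 - p ?x" 0 "- q ?x"] sqrt_sum_squares_le_sum_abs[of "1 - p ?x" "q ?x"]
        by simp
    qed
    have "((\<lambda>x. \<bar>1 - p x\<bar> + \<bar>q x\<bar>) \<longlongrightarrow> \<bar>1 - 1\<bar> + \<bar>0\<bar>) (at 0)"
      by (intro tendsto_intros p_q_tendsto)
    then have "((\<lambda>x. \<bar>1 - p x\<bar> + \<bar>q x\<bar>) \<longlongrightarrow> 0) (at 0)"
      by simp
    from filterlim_compose[OF this exp0]
    show "((\<lambda>t. \<bar>1 - p (exp (- t))\<bar> + \<bar>q (exp (- t))\<bar>) \<longlongrightarrow> 0) at_top" .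
  qed
  have W: "((\<lambda>t. cos (?W t) - cos (\<tau> t)) \<longlongrightarrow> 0) at_top" "((\<lambda>t. sin (?W t) + sin (\<tau> t)) \<longlongrightarrow> 0) at_top"
    using cos_sin_shift_tendsto[OF w_tilde_asymptotics, of "\<lambda>t. - \<tau> t"] by (simp_all add: \<tau>_def)
  \<comment> \<open>The three null terms are chosen so that X_alpha and u cancel; only E1 - b and E2
    - c remain, rotating with constant speed.\<close>
  have "((\<lambda>t. (X\<^sub>\<alpha> (exp (- t), 0) - (cos (\<tau> t) *\<^sub>R b - sin (\<tau> t) *\<^sub>R c)) - (X\<^sub>\<alpha> (exp (- t), 0) - u (exp (- t)) 0) -
      ((cos (?W t) - cos (\<tau> t)) *\<^sub>R E\<^sub>1 + (sin (?W t) + sin (\<tau> t)) *\<^sub>R E\<^sub>2)) \<longlongrightarrow> 0 - 0 - (0 *\<^sub>R E\<^sub>1 + 0 *\<^sub>R E\<^sub>2)) at_top"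
    using bc by (intro tendsto_intros W X_u) (simp_all add: is_bc_inf_def \<tau>_def mult_ac)
  moreover have "(X\<^sub>\<alpha> (exp (- t), 0) - (cos (\<tau> t) *\<^sub>R b - sin (\<tau> t) *\<^sub>R c)) - (X\<^sub>\<alpha> (exp (- t), 0) - u (exp (- t)) 0) -
      ((cos (?W t) - cos (\<tau> t)) *\<^sub>R E\<^sub>1 + (sin (?W t) + sin (\<tau> t)) *\<^sub>R E\<^sub>2) =
      cos (\<tau> t) *\<^sub>R (E\<^sub>1 - b) - sin (\<tau> t) *\<^sub>R (E\<^sub>2 - c)" for t
    using u[of "exp (- t)"] by (simp add: algebra_simps)
  ultimately have "((\<lambda>t. cos (sqrt 5 / 2 * t) *\<^sub>R (E\<^sub>1 - b) - sin (sqrt 5 / 2 * t) *\<^sub>R (E\<^sub>2 - c)) \<longlongrightarrow> 0) at_top"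
    by (simp add: \<tau>_def)
  then have "E\<^sub>1 = b" "E\<^sub>2 = c"
    using rotating_combination_tendsto_0D[of "sqrt 5 / 2" "E\<^sub>1 - b" "E\<^sub>2 - c"] by simp_all
  then show "u x y = cos (w_tilde x) *\<^sub>R b + sin (w_tilde x) *\<^sub>R c"
    and "v x y = - sin (w_tilde x) *\<^sub>R b + cos (w_tilde x) *\<^sub>R c"
    using u v \<open>0 < x\<close> u_independent[of x y 0] v_independent[of x y 0] by simp_all
qed

section \<open>The curve u_vec, its direction of motion, and the frame vectors phi and
  X_beta\<close>

lemma u_vec_eq:
  assumes "0 < x"
  shows "u_vec \<phi> X\<^sub>\<beta> y = (1 / sqrt (1 + y\<^sup>2)) *\<^sub>R (y *\<^sub>R X\<^sub>\<beta> (x, y) - \<phi> (x, y))"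
proof -
  have "((\<lambda>s. y *\<^sub>R X\<^sub>\<beta> (s, y) - \<phi> (s, y)) has_vector_derivative 0) (at s within {0<..})" if "s \<in> {0<..}" for s
  proof (rule has_vector_derivative_at_within)
    have s: "0 < s" using that by simp
    have "((\<lambda>s. y *\<^sub>R X\<^sub>\<beta> (s, y) - \<phi> (s, y)) has_vector_derivative
        y *\<^sub>R c\<^sub>1 s y *\<^sub>R X\<^sub>\<alpha> (s, y) - - a\<^sub>1 s y *\<^sub>R X\<^sub>\<alpha> (s, y)) (at s)"
      by (auto intro!: derivative_eq_intros frame_x s)
    \<comment> \<open>This relation is why y X_beta - phi does not change with x.\<close>
    moreover have "y * c\<^sub>1 s y + a\<^sub>1 s y = 0"
      using s by (simp add: structure_coefficients)
    ultimately show "((\<lambda>s. y *\<^sub>R X\<^sub>\<beta> (s, y) - \<phi> (s, y)) has_vector_derivative 0) (at s)"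
      by (simp flip: scaleR_add_left)
  qed
  then obtain k where "\<And>s. s \<in> {0<..} \<Longrightarrow> y *\<^sub>R X\<^sub>\<beta> (s, y) - \<phi> (s, y) = k"
    using has_vector_derivative_zero_constant[OF convex_real_interval(3)] by blast
  then show ?thesis
    unfolding u_vec_def using assms by (intro the_equality) force+
qed

text \<open>The derivative of u_vec, computed from the frame equations at a fixed x, is compared
  with the one given by \<open>is_bc_tilde_inf\<close>. Cancelling the factor y^2 / (1 + y^2)
  requires y \<noteq> 0.\<close>

lemma v1_vec_eq:
  assumes bct: "is_bc_tilde_inf \<phi> X\<^sub>\<beta> bt ct" and "0 < x" "y \<noteq> 0"
  shows "v1_vec bt ct y = (\<kappa> x y / sqrt (1 + y\<^sup>2)) *\<^sub>R (y *\<^sub>R \<phi> (x, y) + X\<^sub>\<beta> (x, y)) -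
    (2 * sqrt (1 + y\<^sup>2) * \<rho> x / h x y) *\<^sub>R w x y"
proof -
  have nz: "x \<noteq> 0" using \<open>0 < x\<close> by simp
  define \<sigma> where "\<sigma> = sqrt (1 + y\<^sup>2)"
  have pos: "0 < 1 + y\<^sup>2"
    by (simp add: add_pos_nonneg)
  \<comment> \<open>After multiplication by sigma^3 the X_beta coefficient becomes this quantity and
    the phi coefficient y times it; its factor y^2 is the one to be cancelled.\<close>
  have "(1 + y\<^sup>2) * a\<^sub>2 x y + 1 = ((1 + y\<^sup>2) * (y\<^sup>2 * G x - H x) + h x y) / h x y"
    using h_pos[OF nz, of y] by (simp add: structure_coefficients nz add_divide_distrib)
  also have "(1 + y\<^sup>2) * (y\<^sup>2 * G x - H x) + h x y = y\<^sup>2 * ((1 + y\<^sup>2) * G x - (H x - G x))"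
    unfolding h_eq[OF nz] by (simp add: algebra_simps)
  finally have key: "(1 + y\<^sup>2) * a\<^sub>2 x y + 1 = y\<^sup>2 * \<kappa> x y"
    by (simp add: \<kappa>_def)
  have \<sigma>: "0 < \<sigma>" "\<sigma> * \<sigma> = 1 + y\<^sup>2"
    by (simp_all add: \<sigma>_def add_pos_nonneg)
  have "((\<lambda>y. 1 / sqrt (1 + y\<^sup>2)) has_real_derivative - y / (\<sigma> * \<sigma> * \<sigma>)) (at y)"
    using pos unfolding \<sigma>_def by (auto intro!: derivative_eq_intros simp: divide_simps)
  then have "((\<lambda>y. (1 / sqrt (1 + y\<^sup>2)) *\<^sub>R (y *\<^sub>R X\<^sub>\<beta> (x, y) - \<phi> (x, y))) has_vector_derivative
      (1 / sqrt (1 + y\<^sup>2)) *\<^sub>R ((y *\<^sub>R (a\<^sub>2 x y *\<^sub>R \<phi> (x, y) - b\<^sub>2 x y *\<^sub>R \<xi> (x, y) - c\<^sub>2 x y *\<^sub>R X\<^sub>\<alpha> (x, y)) +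
        1 *\<^sub>R X\<^sub>\<beta> (x, y)) - (- a\<^sub>2 x y *\<^sub>R X\<^sub>\<beta> (x, y))) +
      (- y / (\<sigma> * \<sigma> * \<sigma>)) *\<^sub>R (y *\<^sub>R X\<^sub>\<beta> (x, y) - \<phi> (x, y))) (at y)"
    by (intro has_vector_derivative_scaleR has_vector_derivative_diff frame_y \<open>0 < x\<close> DERIV_ident)
  moreover have "((\<lambda>y. (1 / sqrt (1 + y\<^sup>2)) *\<^sub>R (y *\<^sub>R X\<^sub>\<beta> (x, y) - \<phi> (x, y))) has_vector_derivative
      (y\<^sup>2 / (1 + y\<^sup>2)) *\<^sub>R v1_vec bt ct y) (at y)"
    using bct unfolding is_bc_tilde_inf_def u_vec_eq[OF \<open>0 < x\<close>] u_vec_eq[OF \<open>0 < x\<close>, abs_def] by blast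
  ultimately have "(y\<^sup>2 / (\<sigma> * \<sigma>)) *\<^sub>R v1_vec bt ct y =
      (1 / \<sigma>) *\<^sub>R ((y *\<^sub>R (a\<^sub>2 x y *\<^sub>R \<phi> (x, y) - b\<^sub>2 x y *\<^sub>R \<xi> (x, y) - c\<^sub>2 x y *\<^sub>R X\<^sub>\<alpha> (x, y)) +
        1 *\<^sub>R X\<^sub>\<beta> (x, y)) - (- a\<^sub>2 x y *\<^sub>R X\<^sub>\<beta> (x, y))) +
      (- y / (\<sigma> * \<sigma> * \<sigma>)) *\<^sub>R (y *\<^sub>R X\<^sub>\<beta> (x, y) - \<phi> (x, y))"
    unfolding \<sigma>(2) unfolding \<sigma>_def by (rule vector_derivative_unique_at[symmetric])
  also have "\<dots> = (y * a\<^sub>2 x y / \<sigma> + y / (\<sigma> * \<sigma> * \<sigma>)) *\<^sub>R \<phi> (x, y) + (- (y * c\<^sub>2 x y / \<sigma>)) *\<^sub>R X\<^sub>\<alpha> (x, y) +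
      ((1 + a\<^sub>2 x y) / \<sigma> - y\<^sup>2 / (\<sigma> * \<sigma> * \<sigma>)) *\<^sub>R X\<^sub>\<beta> (x, y) + (- (y * b\<^sub>2 x y / \<sigma>)) *\<^sub>R \<xi> (x, y)"
    by (simp add: algebra_simps add_divide_distrib power2_eq_square)
  also have "y * a\<^sub>2 x y / \<sigma> + y / (\<sigma> * \<sigma> * \<sigma>) = y\<^sup>2 / (\<sigma> * \<sigma>) * (\<kappa> x y / \<sigma> * y)"
  proof -
    have "y * a\<^sub>2 x y / \<sigma> + y / (\<sigma> * \<sigma> * \<sigma>) = y * (\<sigma> * \<sigma> * a\<^sub>2 x y + 1) / (\<sigma> * \<sigma> * \<sigma>)"
      using \<sigma>(1) by (simp add: divide_simps algebra_simps)
    then show ?thesis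
      unfolding \<sigma>(2) key by (simp add: mult_ac)
  qed
  also have "(1 + a\<^sub>2 x y) / \<sigma> - y\<^sup>2 / (\<sigma> * \<sigma> * \<sigma>) = y\<^sup>2 / (\<sigma> * \<sigma>) * (\<kappa> x y / \<sigma>)"
  proof -
    have "(1 + a\<^sub>2 x y) / \<sigma> - y\<^sup>2 / (\<sigma> * \<sigma> * \<sigma>) = (\<sigma> * \<sigma> * (1 + a\<^sub>2 x y) - y\<^sup>2) / (\<sigma> * \<sigma> * \<sigma>)"
      using \<sigma>(1) by (simp add: divide_simps)
    also have "\<sigma> * \<sigma> * (1 + a\<^sub>2 x y) - y\<^sup>2 = y\<^sup>2 * \<kappa> x y"
      unfolding \<sigma>(2) key[symmetric] by (simp add: algebra_simps)
    finally show ?thesis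
      by simp
  qed
  also have "- (y * c\<^sub>2 x y / \<sigma>) = y\<^sup>2 / (\<sigma> * \<sigma>) * (- (2 * \<sigma> * \<rho> x / h x y) * q x)"
    using rho_pos[of x] \<sigma>(1) by (simp add: structure_coefficients nz q_def power2_eq_square mult_ac)
  also have "- (y * b\<^sub>2 x y / \<sigma>) = y\<^sup>2 / (\<sigma> * \<sigma>) * ((2 * \<sigma> * \<rho> x / h x y) * p x)"
    using rho_pos[of x] \<sigma>(1) by (simp add: structure_coefficients nz p_def power2_eq_square mult_ac)
  also have "(y\<^sup>2 / (\<sigma> * \<sigma>) * (\<kappa> x y / \<sigma> * y)) *\<^sub>R \<phi> (x, y) +
      (y\<^sup>2 / (\<sigma> * \<sigma>) * (- (2 * \<sigma> * \<rho> x / h x y) * q x)) *\<^sub>R X\<^sub>\<alpha> (x, y) +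
      (y\<^sup>2 / (\<sigma> * \<sigma>) * (\<kappa> x y / \<sigma>)) *\<^sub>R X\<^sub>\<beta> (x, y) +
      (y\<^sup>2 / (\<sigma> * \<sigma>) * ((2 * \<sigma> * \<rho> x / h x y) * p x)) *\<^sub>R \<xi> (x, y) =
      (y\<^sup>2 / (\<sigma> * \<sigma>)) *\<^sub>R ((\<kappa> x y / \<sigma>) *\<^sub>R (y *\<^sub>R \<phi> (x, y) + X\<^sub>\<beta> (x, y)) - (2 * \<sigma> * \<rho> x / h x y) *\<^sub>R w x y)"
    unfolding w_def by (simp only: scaleR_add_right scaleR_diff_right scaleR_scaleR scaleR_minus_left
      mult_minus_left mult_minus_right) simp
  finally show ?thesis
    using \<sigma>(1) \<open>y \<noteq> 0\<close> unfolding \<sigma>_def[symmetric] by simp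
qed

lemma norm_minus_v1_vec:
  assumes bct: "is_bc_tilde_inf \<phi> X\<^sub>\<beta> bt ct" and "0 < x" "y \<noteq> 0"
  shows "norm ((1 / sqrt (1 + y\<^sup>2)) *\<^sub>R (y *\<^sub>R \<phi> (x, y) + X\<^sub>\<beta> (x, y)) - v1_vec bt ct y) =
    2 * sqrt ((H x - G x) / h x y)"
proof -
  have nz: "x \<noteq> 0" using \<open>0 < x\<close> by simp
  define \<sigma> where "\<sigma> = sqrt (1 + y\<^sup>2)"
  have \<sigma>: "0 < \<sigma>" "\<sigma>\<^sup>2 = 1 + y\<^sup>2"
    by (simp_all add: \<sigma>_def add_pos_nonneg)
  let ?m = "2 * \<sigma> * \<rho> x / h x y" and ?k = "(1 - \<kappa> x y) / \<sigma>"
  have "(1 / \<sigma>) *\<^sub>R (y *\<^sub>R \<phi> (x, y) + X\<^sub>\<beta> (x, y)) - v1_vec bt ct y =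
      (?k * y) *\<^sub>R \<phi> (x, y) + (?m * q x) *\<^sub>R X\<^sub>\<alpha> (x, y) + ?k *\<^sub>R X\<^sub>\<beta> (x, y) + (- (?m * p x)) *\<^sub>R \<xi> (x, y)"
    unfolding v1_vec_eq[OF assms] w_def \<sigma>_def[symmetric]
    by (simp add: algebra_simps diff_divide_distrib)
  then have "norm ((1 / \<sigma>) *\<^sub>R (y *\<^sub>R \<phi> (x, y) + X\<^sub>\<beta> (x, y)) - v1_vec bt ct y) =
      sqrt ((?k * y)\<^sup>2 + (?m * q x)\<^sup>2 + ?k\<^sup>2 + (- (?m * p x))\<^sup>2)"
    by (simp only: norm_frame_combination[OF \<open>0 < x\<close>])
  also have "(?k * y)\<^sup>2 + (?m * q x)\<^sup>2 + ?k\<^sup>2 + (- (?m * p x))\<^sup>2 =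
      ?k\<^sup>2 * (1 + y\<^sup>2) + ?m\<^sup>2 * ((p x)\<^sup>2 + (q x)\<^sup>2)"
    unfolding power2_minus power_mult_distrib[of _ y] power_mult_distrib[of _ "p x"] power_mult_distrib[of _ "q x"]
    by (simp add: distrib_left)
  also have "?k\<^sup>2 * (1 + y\<^sup>2) = (1 - \<kappa> x y)\<^sup>2"
    unfolding \<sigma>(2)[symmetric] using \<sigma>(1) by (simp add: power_divide)
  also have "?m\<^sup>2 * ((p x)\<^sup>2 + (q x)\<^sup>2) = (1 + y\<^sup>2) * (2 * \<rho> x / h x y)\<^sup>2"
    unfolding \<sigma>(2)[symmetric] p_q_square by (simp add: power_divide power_mult_distrib)
  also have "(1 - \<kappa> x y)\<^sup>2 + \<dots> = 4 * ((H x - G x) / h x y)"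
    using kappa_rotation[OF nz, of y] by simp
  finally show ?thesis
    unfolding \<sigma>_def by (simp only: real_sqrt_mult real_sqrt_four)
qed

text \<open>Both subtracted vectors arise by rotating X_beta and phi in their plane by the angle
  with cosine y / sigma and sine 1 / sigma. From y \<le> sigma \<le> 1 + y, both 1 - y / sigma and 1
  / sigma are at most 1 / y.\<close>

lemma norm_frame_rotation_le:
  assumes "0 < x" "0 < y"
  shows "norm (X\<^sub>\<beta> (x, y) - (1 / sqrt (1 + y\<^sup>2)) *\<^sub>R (y *\<^sub>R X\<^sub>\<beta> (x, y) - \<phi> (x, y))) \<le> 2 / y"
    and "norm (\<phi> (x, y) - (1 / sqrt (1 + y\<^sup>2)) *\<^sub>R (y *\<^sub>R \<phi> (x, y) + X\<^sub>\<beta> (x, y))) \<le> 2 / y"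
proof -
  define \<sigma> where "\<sigma> = sqrt (1 + y\<^sup>2)"
  have "y \<le> \<sigma>" "\<sigma> \<le> 1 + y"
    using \<open>0 < y\<close> by (auto simp: \<sigma>_def power2_sum intro!: real_le_rsqrt real_le_lsqrt)
  then have \<sigma>: "0 < \<sigma>" "0 \<le> 1 - y / \<sigma>" "1 / \<sigma> \<le> 1 / y" "(\<sigma> - y) / \<sigma> \<le> 1 / \<sigma>"
    using \<open>0 < y\<close> by (auto simp: frac_le intro: divide_right_mono)
  then have le: "1 - y / \<sigma> \<le> 1 / \<sigma>"
    by (simp add: diff_divide_distrib)
  have bound: "sqrt (r\<^sup>2 + s\<^sup>2) \<le> 2 / y" if "\<bar>r\<bar> = 1 - y / \<sigma>" "\<bar>s\<bar> = 1 / \<sigma>" for r s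
    using sqrt_sum_squares_le_sum_abs[of r s] that \<sigma>(3) le by simp
  have "X\<^sub>\<beta> (x, y) - (1 / \<sigma>) *\<^sub>R (y *\<^sub>R X\<^sub>\<beta> (x, y) - \<phi> (x, y)) =
      (1 / \<sigma>) *\<^sub>R \<phi> (x, y) + 0 *\<^sub>R X\<^sub>\<alpha> (x, y) + (1 - y / \<sigma>) *\<^sub>R X\<^sub>\<beta> (x, y) + 0 *\<^sub>R \<xi> (x, y)"
    by (simp add: algebra_simps)
  then show "norm (X\<^sub>\<beta> (x, y) - (1 / sqrt (1 + y\<^sup>2)) *\<^sub>R (y *\<^sub>R X\<^sub>\<beta> (x, y) - \<phi> (x, y))) \<le> 2 / y"
    unfolding \<sigma>_def[symmetric] using bound[of "1 - y / \<sigma>" "1 / \<sigma>"] \<sigma>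
    by (simp only: norm_frame_combination[OF \<open>0 < x\<close>]) (simp add: add.commute)
  have "\<phi> (x, y) - (1 / \<sigma>) *\<^sub>R (y *\<^sub>R \<phi> (x, y) + X\<^sub>\<beta> (x, y)) =
      (1 - y / \<sigma>) *\<^sub>R \<phi> (x, y) + 0 *\<^sub>R X\<^sub>\<alpha> (x, y) + (- (1 / \<sigma>)) *\<^sub>R X\<^sub>\<beta> (x, y) + 0 *\<^sub>R \<xi> (x, y)"
    by (simp add: algebra_simps)
  then show "norm (\<phi> (x, y) - (1 / sqrt (1 + y\<^sup>2)) *\<^sub>R (y *\<^sub>R \<phi> (x, y) + X\<^sub>\<beta> (x, y))) \<le> 2 / y"
    unfolding \<sigma>_def[symmetric] using bound[of "1 - y / \<sigma>" "1 / \<sigma>"] \<sigma>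
    by (simp only: norm_frame_combination[OF \<open>0 < x\<close>]) simp
qed

lemma X_beta_converges:
  assumes bct: "is_bc_tilde_inf \<phi> X\<^sub>\<beta> bt ct"
  shows "converges_uniformly_wide (\<lambda>x y. X\<^sub>\<beta> (x, y)) (\<lambda>x. b_tilde bt ct)"
proof (rule converges_uniformly_wideI)
  let ?c = "\<lambda>y. - sin (y - arctan y) *\<^sub>R bt + cos (y - arctan y) *\<^sub>R ct"
  \<comment> \<open>The constant factor 1 suffices because u_vec lies exactly on its circle; the
    estimate is uniform in all x > 0.\<close>
  show "continuous_on {0<..} (\<lambda>x. 1)" by simp
  have "((\<lambda>y. 2 * (1 / y) + norm (?c y - b_tilde bt ct y)) \<longlongrightarrow> 2 * 0 + norm (0 :: real ^ 4)) at_top"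
    by (intro tendsto_intros shifted_circle_tendsto inverse_tendsto_0)
  then show "((\<lambda>y. 2 * (1 / y) + norm (?c y - b_tilde bt ct y)) \<longlongrightarrow> 0) at_top"
    by simp
  fix x y :: real assume "0 < x" "0 < y"
  have "?c y = (1 / sqrt (1 + y\<^sup>2)) *\<^sub>R (y *\<^sub>R X\<^sub>\<beta> (x, y) - \<phi> (x, y))"
    using bct u_vec_eq[OF \<open>0 < x\<close>, of y] by (simp add: is_bc_tilde_inf_def)
  then have "norm (X\<^sub>\<beta> (x, y) - ?c y) \<le> 2 / y"
    using norm_frame_rotation_le(1)[OF \<open>0 < x\<close> \<open>0 < y\<close>] by simp
  then show "norm (X\<^sub>\<beta> (x, y) - b_tilde bt ct y) \<le> 1 * (2 * (1 / y) + norm (?c y - b_tilde bt ct y))"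
    using norm_triangle_ineq[of "X\<^sub>\<beta> (x, y) - ?c y" "?c y - b_tilde bt ct y"] by simp
qed

lemma phi_converges:
  assumes bct: "is_bc_tilde_inf \<phi> X\<^sub>\<beta> bt ct"
  shows "converges_uniformly_wide (\<lambda>x y. \<phi> (x, y)) (\<lambda>x. c_tilde bt ct)"
proof (rule converges_uniformly_wideI)
  \<comment> \<open>The summand 2 comes from the frame rotation, the root from the distance to
    \<open>v1_vec\<close>. As \<open>?K\<close> is at least 1, it also absorbs the x-independent
    circle error.\<close>
  let ?K = "\<lambda>x. 2 + 2 * sqrt ((H x - G x) / G x)"
  let ?\<beta> = "\<lambda>y. 1 / y + norm (v1_vec bt ct y - c_tilde bt ct y)"
  have "G x \<noteq> 0" for x
    using G_pos[of x] by simp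
  then show "continuous_on {0<..} ?K"
    by (intro continuous_intros continuous_on_G continuous_on_H) auto
  have "(?\<beta> \<longlongrightarrow> 0 + norm (0 :: real ^ 4)) at_top"
    by (intro tendsto_intros shifted_circle_tendsto inverse_tendsto_0)
  then show "(?\<beta> \<longlongrightarrow> 0) at_top"
    by simp
  fix x y :: real assume "0 < x" "0 < y"
  then have nz: "x \<noteq> 0" "y \<noteq> 0" by simp_all
  let ?e = "(1 / sqrt (1 + y\<^sup>2)) *\<^sub>R (y *\<^sub>R \<phi> (x, y) + X\<^sub>\<beta> (x, y))"
  let ?n = "norm (v1_vec bt ct y - c_tilde bt ct y)"
  have "(H x - G x) / h x y \<le> (H x - G x) / (y\<^sup>2 * G x)"
    using h_ge[OF nz(1), of y] G_pos[of x] H_minus_G_pos[of x] h_pos[OF nz(1), of y] \<open>0 < y\<close>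
    by (intro divide_left_mono) auto
  then have "sqrt ((H x - G x) / h x y) \<le> sqrt ((H x - G x) / G x / y\<^sup>2)"
    by (intro real_sqrt_le_mono) (simp add: mult.commute)
  also have "\<dots> = sqrt ((H x - G x) / G x) * (1 / y)"
    using \<open>0 < y\<close> unfolding real_sqrt_divide[of _ "y\<^sup>2"] by simp
  finally have "norm (?e - v1_vec bt ct y) \<le> 2 * sqrt ((H x - G x) / G x) * (1 / y)"
    using norm_minus_v1_vec[OF bct \<open>0 < x\<close> nz(2)] by simp
  moreover have "norm (\<phi> (x, y) - ?e) \<le> 2 * (1 / y)"
    using norm_frame_rotation_le(2)[OF \<open>0 < x\<close> \<open>0 < y\<close>] by simp
  ultimately have "norm (\<phi> (x, y) - c_tilde bt ct y) \<le> ?K x * (1 / y) + ?n"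
    using norm_triangle_ineq[of "\<phi> (x, y) - ?e" "?e - c_tilde bt ct y"]
      norm_triangle_ineq[of "?e - v1_vec bt ct y" "v1_vec bt ct y - c_tilde bt ct y"]
    by (simp add: add_divide_distrib)
  also have "?n \<le> ?K x * ?n"
  proof -
    have "0 \<le> sqrt ((H x - G x) / G x)"
      using G_pos[of x] H_minus_G_pos[of x] by simp
    then have "1 \<le> ?K x"
      by simp
    from mult_right_mono[OF this norm_ge_zero] show ?thesis
      by simp
  qed
  finally show "norm (\<phi> (x, y) - c_tilde bt ct y) \<le> ?K x * ?\<beta> y"
    by (simp only: distrib_left)
qed

lemma surface_converges:
  assumes f: "curvature_surface X\<^sub>\<alpha> X\<^sub>\<beta> f"
  shows "converges_uniformly_wide (\<lambda>x y. f (x, y)) (\<lambda>x y. (1 / \<rho> x) *\<^sub>R v x 0 + A_tilde X\<^sub>\<alpha> \<xi> f x)"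
proof (rule converges_uniformly_wideI)
  have "G x \<noteq> 0" for x
    using G_pos[of x] by simp
  then show "continuous_on {0<..} (\<lambda>x. 2 / G x)"
    by (intro continuous_intros continuous_on_G) auto
  show "norm (f (x, y) - ((1 / \<rho> x) *\<^sub>R v x 0 + A_tilde X\<^sub>\<alpha> \<xi> f x)) \<le> 2 / G x * (1 / y)"
    if "0 < x" "0 < y" for x y
    by (rule norm_surface_minus_limit[OF f that])
qed (rule inverse_tendsto_0)

end

theorem theorem4p9:
  fixes \<phi> X\<^sub>\<alpha> X\<^sub>\<beta> \<xi> f :: "real \<times> real \<Rightarrow> real ^ 4"
    and b c bt ct :: "real ^ 4"
  assumes "frame_field \<phi> X\<^sub>\<alpha> X\<^sub>\<beta> \<xi>"
    and "curvature_surface X\<^sub>\<alpha> X\<^sub>\<beta> f"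
    and "is_bc_inf X\<^sub>\<alpha> b c"
    and "is_bc_tilde_inf \<phi> X\<^sub>\<beta> bt ct"
    and "orthonormal [b, c, bt, ct]"
  shows "(\<exists>v1 :: real \<Rightarrow> real ^ 4.
            (\<forall>x > 0.
               norm (v1 x) = 1 \<and>
               (u_tilde X\<^sub>\<alpha> \<xi> has_vector_derivative T x *\<^sub>R v1 x) (at x) \<and>
               (v1 has_vector_derivative - T x *\<^sub>R u_tilde X\<^sub>\<alpha> \<xi> x) (at x) \<and>
               u_tilde X\<^sub>\<alpha> \<xi> x = cos (w_tilde x) *\<^sub>R b + sin (w_tilde x) *\<^sub>R c \<and>
               v1 x = - sin (w_tilde x) *\<^sub>R b + cos (w_tilde x) *\<^sub>R c) \<and>
            (\<forall>x > 0. converges_uniformly (\<lambda>y. f (x, y))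
               (\<lambda>y. (1 / sqrt ((B\<^sub>2 x)\<^sup>2 + (C\<^sub>2 x)\<^sup>2)) *\<^sub>R v1 x + A_tilde X\<^sub>\<alpha> \<xi> f x)) \<and>
            converges_uniformly_wide (\<lambda>x y. f (x, y))
               (\<lambda>x y. (1 / sqrt ((B\<^sub>2 x)\<^sup>2 + (C\<^sub>2 x)\<^sup>2)) *\<^sub>R v1 x + A_tilde X\<^sub>\<alpha> \<xi> f x)) \<and>
         (\<forall>x > 0. converges_uniformly (\<lambda>y. X\<^sub>\<beta> (x, y)) (b_tilde bt ct)) \<and>
         converges_uniformly_wide (\<lambda>x y. X\<^sub>\<beta> (x, y)) (\<lambda>x. b_tilde bt ct) \<and>
         (\<forall>x > 0. converges_uniformly (\<lambda>y. \<phi> (x, y)) (c_tilde bt ct)) \<and>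
         converges_uniformly_wide (\<lambda>x y. \<phi> (x, y)) (\<lambda>x. c_tilde bt ct)"
proof -
  interpret frame_field_context \<phi> X\<^sub>\<alpha> X\<^sub>\<beta> \<xi>
    by standard fact
  let ?v = "\<lambda>x. v x 0"
  let ?lim = "\<lambda>x (y::real). (1 / sqrt ((B\<^sub>2 x)\<^sup>2 + (C\<^sub>2 x)\<^sup>2)) *\<^sub>R v x 0 + A_tilde X\<^sub>\<alpha> \<xi> f x"
  have *: "norm (?v x) = 1 \<and>
      (u_tilde X\<^sub>\<alpha> \<xi> has_vector_derivative T x *\<^sub>R ?v x) (at x) \<and>
      (?v has_vector_derivative - T x *\<^sub>R u_tilde X\<^sub>\<alpha> \<xi> x) (at x) \<and>
      u_tilde X\<^sub>\<alpha> \<xi> x = cos (w_tilde x) *\<^sub>R b + sin (w_tilde x) *\<^sub>R c \<and>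
      ?v x = - sin (w_tilde x) *\<^sub>R b + cos (w_tilde x) *\<^sub>R c" if "0 < x" for x
  proof (intro conjI)
    show v: "?v x = - sin (w_tilde x) *\<^sub>R b + cos (w_tilde x) *\<^sub>R c"
      and "u_tilde X\<^sub>\<alpha> \<xi> x = cos (w_tilde x) *\<^sub>R b + sin (w_tilde x) *\<^sub>R c"
      using u_v_eq[OF assms(3) that, of 0] u_tilde_eq[OF that, of 0] by simp_all
    show "(?v has_vector_derivative - T x *\<^sub>R u_tilde X\<^sub>\<alpha> \<xi> x) (at x)"
      using v_has_derivative[OF that] u_tilde_eq[OF that, of 0] by simp
    \<comment> \<open>The identity of \<open>u_tilde\<close> with u is available for positive
      arguments, so the derivative is transferred along that open set.\<close>
    show "(u_tilde X\<^sub>\<alpha> \<xi> has_vector_derivative T x *\<^sub>R ?v x) (at x)"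
      using u_has_derivative[OF that] open_greaterThan
      by (rule has_vector_derivative_transform_within_open) (use that u_tilde_eq in auto)
    have "orthonormal [b, c]"
      using assms(3) by (simp add: is_bc_inf_def)
    then have "b \<bullet> b = 1" "c \<bullet> c = 1" "b \<bullet> c = 0" "c \<bullet> b = 0"
      by (auto simp: orthonormal_def numeral_eq_Suc All_less_Suc)
    then show "norm (?v x) = 1"
      unfolding v norm_eq_sqrt_inner
      by (simp add: inner_add_left inner_add_right inner_diff_left inner_diff_right flip: power2_eq_square)
  qed
  have f_wide: "converges_uniformly_wide (\<lambda>x y. f (x, y)) ?lim"
    using surface_converges[OF assms(2)]
    by (rule converges_uniformly_wide_cong[THEN iffD1, rotated]) (simp add: \<rho>_def B\<^sub>2_eq C\<^sub>2_eq)
  note X_wide = X_beta_converges[OF assms(4)] and phi_wide = phi_converges[OF assms(4)]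
  show ?thesis
    using * f_wide X_wide phi_wide converges_uniformly_if_wide[OF f_wide]
      converges_uniformly_if_wide[OF X_wide] converges_uniformly_if_wide[OF phi_wide]
    by (intro conjI exI[of _ ?v]) blast+
qed

end
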